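(* For $|q|<1$, \begin{align*} \sum_{n=0}^\infty \frac{q^{n(n+1)/2}(-1;q)_n}{(q;q)_n} \sum_{i=0}^n q^{i^2} {n \brack i}_q &=\frac{(q^2;q^2)_\infty (q^3;q^3)_\infty^2}{(q;q)_\infty^2 (q^6;q^6)_\infty},\\ \sum_{n=0}^\infty \frac{q^{n(n+1)/2}(-q;q)_n}{(q;q)_n} \sum_{i=0}^n q^{i^2+i}{n \brack i}_q &=\frac{(q^6;q^6)_\infty^2}{(q;q)_\infty (q^3;q^3)_\infty},\\ \sum_{n=0}^\infty \frac{q^{n^2}(-q;q^2)_n}{(q^2;q^2)_n} \sum_{i=0}^n q^{2i^2} {n\brack i}_{q^2} &=\frac{(-q;q^2)_\infty (q^5,q^7,q^{12};q^{12})_\infty}{(q^2;q^2)_\infty},\\ \sum_{n=0}^\infty \frac{q^{n^2}(-q;q^2)_n}{(q^2;q^2)_n} \sum_{i=0}^n q^{2i^2+2i} {n\brack i}_{q^2} &=\frac{(-q;q^2)_\infty (q^3,q^9,q^{12};q^{12})_\infty}{(q^2;q^2)_\infty},\\ \sum_{n=0}^\infty \frac{q^{n^2+2n}(-q;q^2)_n}{(q^2;q^2)_n} \sum_{i=0}^n q^{2i^2+2i} {n\brack i}_{q^2} &=\frac{(-q;q^2)_\infty (q,q^{11},q^{12};q^{12})_\infty}{(q^2;q^2)_\infty}. \end{align*}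
   Context: For $|q|<1$: $(a;q)_0=1$, $(a;q)_n=\prod_{k=0}^{n-1}(1-aq^k)$, $(a;q)_\infty=\prod_{k\ge0}(1-aq^k)$, $(a_1,\dots,a_m;q)_n=\prod_{\ell}(a_\ell;q)_n$. The Gaussian coefficient ${n\brack m}_q=\frac{(q;q)_n}{(q;q)_m(q;q)_{n-m}}$ for $0\le m\le n$ and $0$ otherwise; ${n\brack m}_{q^2}$ is the same with $q$ replaced by $q^2$. *)

theory Defs
  imports "HOL-Analysis.Analysis"
begin

definition qpoch :: "complex \<Rightarrow> complex \<Rightarrow> nat \<Rightarrow> complex" where
  "qpoch a q n = (\<Prod>k<n. 1 - a * q ^ k)"

definition qpoch_inf :: "complex \<Rightarrow> complex \<Rightarrow> complex" where
  "qpoch_inf a q = (\<Prod>k. 1 - a * q ^ k)"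

definition qbinom :: "complex \<Rightarrow> nat \<Rightarrow> nat \<Rightarrow> complex" where
  "qbinom q n m = (if m \<le> n then qpoch q q n / (qpoch q q m * qpoch q q (n - m)) else 0)"

end

theory Submission
  imports Defs
begin

text \<open>
  Each identity is an instance of the Bailey chain. Applying the step
  \<open>\<beta>'\<^sub>n = \<Sum>\<^sub>i q\<^bsup>i\<^sup>2+si\<^esup> \<beta>\<^sub>i / (q;q)\<^bsub>n-i\<^esub>\<close>, \<open>\<alpha>'\<^sub>r = q\<^bsup>r\<^sup>2+sr\<^esup> \<alpha>\<^sub>r\<close> twice to the unit Bailey pair
  relative to \<open>a = q\<^sup>s\<close>, with \<open>s \<in> {0,1}\<close>, turns \<open>\<beta>\<close> into the inner sum divided by \<open>(q;q)\<^sub>n\<close>. A limiting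
  case of Bailey's lemma with one free parameter \<open>x = aq/\<rho>\<close> then evaluates the outer sum as an infinite
  product times a theta series, to which the Jacobi triple product applies. In the fourth identity the
  inner sum belongs to \<open>a = q\<close> and the outer one to \<open>a = 1\<close> (in base \<open>q\<^sup>2\<close>), so the pair is first moved
  from \<open>a = q\<close> to \<open>a = 1\<close>.
\<close>

subsection \<open>Finite and infinite q-Pochhammer symbols\<close>

lemma qpoch_0 [simp]: "qpoch a q 0 = 1"
  by (simp add: qpoch_def)

lemma qpoch_Suc: "qpoch a q (Suc n) = qpoch a q n * (1 - a * q ^ n)"
  by (simp add: qpoch_def)

lemma qpoch_zero_left [simp]: "qpoch 0 q n = 1"
  by (simp add: qpoch_def)

lemma qpoch_add: "qpoch a q (m + n) = qpoch a q m * qpoch (a * q ^ m) q n"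
  by (induction n) (simp_all add: qpoch_Suc power_add mult_ac)

lemma qpoch_Suc_left: "qpoch a q (Suc n) = (1 - a) * qpoch (a * q) q n"
  using qpoch_add[of a q 1 n] by (simp add: qpoch_Suc)

lemma qpoch_qq_Suc: "qpoch q q (Suc n) = qpoch q q n * (1 - q ^ Suc n)"
  by (simp add: qpoch_Suc)

lemma one_minus_power_nonzero:
  fixes q :: complex
  assumes "norm q < 1"
  shows "1 - q ^ Suc n \<noteq> 0"
proof
  assume "1 - q ^ Suc n = 0"
  then have "norm q ^ Suc n = 1" by (metis eq_iff_diff_eq_0 norm_one norm_power)
  then show False using assms power_Suc_less_one[of "norm q" n]
    by (metis norm_ge_zero norm_zero one_neq_zero less_irrefl power_0_Suc zero_less_norm_iff)
qed

lemma qpoch_qq_nonzero: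
  assumes "norm q < 1"
  shows "qpoch q q n \<noteq> 0"
  by (induction n) (simp_all only: qpoch_0 qpoch_qq_Suc mult_eq_0_iff one_minus_power_nonzero[OF assms] not_False_eq_True one_neq_zero simp_thms)

lemma qpoch_convergent:
  fixes a q :: complex
  assumes "norm q < 1"
  shows "convergent_prod (\<lambda>k. 1 - a * q ^ k)"
  using assms
  by (intro abs_convergent_prod_imp_convergent_prod summable_imp_abs_convergent_prod)
     (simp add: norm_mult norm_power summable_mult)

lemma qpoch_tendsto:
  assumes "norm q < 1"
  shows "(\<lambda>n. qpoch a q n) \<longlonglongrightarrow> qpoch_inf a q"
  unfolding qpoch_def qpoch_inf_def
  by (intro has_prod_imp_tendsto' convergent_prod_has_prod qpoch_convergent assms)

lemma qpoch_inf_qq_nonzero: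
  assumes "norm q < 1"
  shows "qpoch_inf q q \<noteq> 0"
  unfolding qpoch_inf_def
  using one_minus_power_nonzero[OF assms]
  by (intro prodinf_nonzero qpoch_convergent assms) simp

lemma qpoch_inf_split:
  assumes "norm q < 1"
  shows "qpoch_inf a q = qpoch a q n * qpoch_inf (a * q ^ n) q"
proof (rule LIMSEQ_unique)
  show "(\<lambda>k. qpoch a q (n + k)) \<longlonglongrightarrow> qpoch_inf a q"
    using LIMSEQ_ignore_initial_segment[OF qpoch_tendsto[OF assms, of a], of n] by
        (simp add: add.commute)
  show "(\<lambda>k. qpoch a q (n + k)) \<longlonglongrightarrow> qpoch a q n * qpoch_inf (a * q ^ n) q"
    unfolding qpoch_add by (intro tendsto_intros qpoch_tendsto assms)
qed

text \<open>Sorts the factors by the residue of their exponent modulo \<open>k\<close>; each residue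
  class is a product in base \<open>q ^ k\<close>.\<close>

lemma qpoch_multisection: "qpoch a q (k * n) = (\<Prod>j<k. qpoch (a * q ^ j) (q ^ k) n)"
proof (induction n)
  case (Suc n)
  have "qpoch a q (k * Suc n) = qpoch a q (k * n) * qpoch (a * q ^ (k * n)) q k"
    by (simp add: qpoch_add[symmetric] add.commute)
  also have "qpoch (a * q ^ (k * n)) q k = (\<Prod>j<k. 1 - a * q ^ j * (q ^ k) ^ n)"
    by (simp add: qpoch_def power_mult mult_ac)
  finally show ?case by (simp add: Suc qpoch_Suc prod.distrib)
qed simp

lemma qpoch_inf_multisection:
  assumes "norm q < 1" "0 < k"
  shows "qpoch_inf a q = (\<Prod>j<k. qpoch_inf (a * q ^ j) (q ^ k))"
proof (rule LIMSEQ_unique)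
  have "filterlim (\<lambda>n. k * n) at_top sequentially"
    using assms(2) by (intro filterlim_subseq strict_monoI) simp
  then show "(\<lambda>n. qpoch a q (k * n)) \<longlonglongrightarrow> qpoch_inf a q"
    using filterlim_compose[OF qpoch_tendsto[OF assms(1)]] by blast
  have "norm (q ^ k) < 1"
    using assms by (simp add: norm_power power_less_one_iff)
  then show "(\<lambda>n. qpoch a q (k * n)) \<longlonglongrightarrow> (\<Prod>j<k. qpoch_inf (a * q ^ j) (q ^ k))"
    unfolding qpoch_multisection by (intro tendsto_prod qpoch_tendsto)
qed

lemma qpoch_inf_mult_minus:
  assumes "norm q < 1"
  shows "qpoch_inf a q * qpoch_inf (- a) q = qpoch_inf (a ^ 2) (q ^ 2)"
proof (rule LIMSEQ_unique)
  show "(\<lambda>n. qpoch a q n * qpoch (- a) q n) \<longlonglongrightarrow> qpoch_inf a q * qpoch_inf (- a) q"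
    by (intro tendsto_intros qpoch_tendsto assms)
  have "qpoch a q n * qpoch (- a) q n = qpoch (a ^ 2) (q ^ 2) n" for n
    by (induction n) (simp_all add: qpoch_Suc power2_eq_square algebra_simps power_mult_distrib)
  moreover have "norm (q ^ 2) < 1"
    using assms by (simp add: norm_power power_less_one_iff)
  ultimately show "(\<lambda>n. qpoch a q n * qpoch (- a) q n) \<longlonglongrightarrow> qpoch_inf (a ^ 2) (q ^ 2)"
    by (simp add: qpoch_tendsto)
qed

section \<open>Uniform bounds and interchange of limit and summation\<close>

lemma qpoch_norm_le:
  assumes "norm q < 1"
  shows "norm (qpoch a q n) \<le> exp (norm a / (1 - norm q))"
proof -
  have "norm (qpoch a q n) \<le> (\<Prod>k<n. exp (norm a * norm q ^ k))"
    unfolding qpoch_def prod_norm[symmetric]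
  proof (intro prod_mono conjI norm_ge_zero)
    fix k
    have "norm (1 - a * q ^ k) \<le> 1 + norm a * norm q ^ k"
      using norm_triangle_ineq4[of 1 "a * q ^ k"] by (simp add: norm_mult norm_power)
    also have "\<dots> \<le> exp (norm a * norm q ^ k)" by (rule exp_ge_add_one_self)
    finally show "norm (1 - a * q ^ k) \<le> exp (norm a * norm q ^ k)" .
  qed
  also have "\<dots> = exp (norm a * (\<Sum>k<n. norm q ^ k))"
    by (simp add: exp_sum sum_distrib_left)
  also have "(\<Sum>k<n. norm q ^ k) \<le> (\<Sum>k. norm q ^ k)"
    using assms by (intro sum_le_suminf) auto
  also have "(\<Sum>k. norm q ^ k) = 1 / (1 - norm q)"
    using assms by (simp add: suminf_geometric)
  finally show ?thesis by (simp add: mult_left_mono)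
qed

lemma inverse_qpoch_bounded:
  assumes "norm q < 1"
  obtains K where "0 < K" "\<And>n. norm (1 / qpoch q q n) \<le> K"
proof -
  have "(\<lambda>n. 1 / qpoch q q n) \<longlonglongrightarrow> 1 / qpoch_inf q q"
    by (intro tendsto_intros qpoch_tendsto qpoch_inf_qq_nonzero assms)
  then have "Bseq (\<lambda>n. 1 / qpoch q q n)"
    by (intro convergent_imp_Bseq) (auto simp: convergent_def)
  then show ?thesis using that by (auto simp: Bseq_def)
qed

text \<open>Tannery's theorem for sums whose range grows with \<open>n\<close>. Extending the
  summands by 0 beyond \<open>k \<le> n\<close> turns the growing range into a fixed infinite
  one.\<close>

lemma tannery_triangular:
  fixes f :: "nat \<Rightarrow> nat \<Rightarrow> complex"
  assumes lim: "\<And>k. (\<lambda>n. f k n) \<longlonglongrightarrow> b k"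
    and bound: "\<And>k n. k \<le> n \<Longrightarrow> norm (f k n) \<le> M k"
    and M: "summable M"
  shows "(\<lambda>n. \<Sum>k\<le>n. f k n) \<longlonglongrightarrow> suminf b" "summable b"
proof -
  define g where "g k n = (if k \<le> n then f k n else 0)" for k n
  have M0: "0 \<le> M k" for k
    using bound[of k k] norm_ge_zero order_trans by blast
  have "eventually (\<lambda>n. summable (\<lambda>k. norm (g k n))) sequentially \<and>
      summable (\<lambda>n. norm (b n)) \<and> (\<lambda>n. \<Sum>k. g k n) \<longlonglongrightarrow> suminf b"
  proof (rule tannerys_theorem)
    fix k
    have "eventually (\<lambda>n. f k n = g k n) sequentially"
      using eventually_ge_at_top[of k] by eventually_elim (simp add: g_def)
    with lim[of k] show "(\<lambda>n. g k n) \<longlonglongrightarrow> b k"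
      by (rule Lim_transform_eventually)
  next
    show "\<forall>\<^sub>F (k, n) in sequentially \<times>\<^sub>F sequentially. norm (g k n) \<le> M k"
      using bound M0 by (intro always_eventually) (auto simp: g_def)
  qed (use M in simp_all)
  moreover have "(\<Sum>k. g k n) = (\<Sum>k\<le>n. f k n)" for n
    by (subst suminf_finite[of "{..n}"]) (auto simp: g_def)
  ultimately show "(\<lambda>n. \<Sum>k\<le>n. f k n) \<longlonglongrightarrow> suminf b" "summable b"
    by (auto intro: summable_norm_cancel)
qed

text \<open>The ratio of consecutive terms is \<open>g n\<close>, which tends to 0, so the ratio
  test applies. This covers sequences with the decay of \<open>q ^ (n choose 2)\<close> without
  using a closed form.\<close>

lemma summable_norm_prod:
  fixes g :: "nat \<Rightarrow> complex"
  assumes "g \<longlonglongrightarrow> 0"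
  shows "summable (\<lambda>n. norm (\<Prod>i<n. g i))"
proof -
  obtain N where N: "\<And>n. n \<ge> N \<Longrightarrow> norm (g n) < 1 / 2"
    using LIMSEQ_D[OF assms, of "1/2"] by auto
  show ?thesis
  proof (rule summable_ratio_test[of "1/2" N])
    fix n assume "N \<le> n"
    then show "norm (norm (\<Prod>i<Suc n. g i)) \<le> 1 / 2 * norm (norm (\<Prod>i<n. g i))"
      using mult_right_mono[OF less_imp_le[OF N[of n]], of "norm (\<Prod>i<n. g i)"] by
          (simp add: norm_mult mult.commute)
  qed simp
qed

subsection \<open>Bailey pairs\<close>

lemma power_double:
  fixes q :: complex
  shows "q ^ (2 * n) = q ^ n * q ^ n" "q ^ (n * 2) = q ^ n * q ^ n"
  by (simp_all add: mult_2 mult_2_right power_add)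

text \<open>Writing \<open>x = aq/\<rho>\<close> with \<open>a = q\<^sup>s\<close>, this is \<open>(\<rho>;q)\<^sub>n (-x)\<^sup>n q\<^bsup>n(n-1)/2\<^esup>\<close>, in a form that still makes
  sense at \<open>x = 0\<close>, i.e. \<open>\<rho> = \<infinity>\<close>.\<close>

definition bailey_weight :: "complex \<Rightarrow> nat \<Rightarrow> complex \<Rightarrow> nat \<Rightarrow> complex" where
  "bailey_weight q s x n = (\<Prod>i<n. q ^ i * (q ^ (s + 1 + i) - x))"

lemma bailey_weight_0 [simp]: "bailey_weight q s x 0 = 1"
  by (simp add: bailey_weight_def)

lemma bailey_weight_Suc:
  "bailey_weight q s x (Suc n) = bailey_weight q s x n * (q ^ n * (q ^ (s + 1 + n) - x))"
  by (simp add: bailey_weight_def)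

lemma bailey_weight_Suc_left:
  "bailey_weight q s x (Suc n) = (q ^ (s + 1) - x) * q ^ n * bailey_weight q (Suc s) x n"
  unfolding bailey_weight_def prod.lessThan_Suc_shift
  by (simp add: prod.distrib mult_ac)

text \<open>Starting the product at index \<open>r\<close> moves a factor \<open>q ^ r\<close> into
  the bracket. The shifted parameters are the ones at which the kernel sum is needed in Bailey's
  lemma.\<close>

lemma bailey_weight_add:
  "bailey_weight q s x (r + j) = bailey_weight q s x r * bailey_weight q (2 * r + s) (x * q ^ r) j"
proof (induction j)
  case (Suc j)
  have "q ^ (r + j) * (q ^ (s + 1 + (r + j)) - x) = q ^ j * (q ^ (2 * r + s + 1 + j) - x * q ^ r)"
    by (simp add: power_add power_double algebra_simps)
  then show ?case by (simp only: add_Suc_right bailey_weight_Suc Suc mult.assoc)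
qed simp

lemma bailey_weight_zero: "bailey_weight q s 0 n = q ^ (n ^ 2 + s * n)"
  by (induction n) (simp_all add: bailey_weight_Suc power_add power2_eq_square algebra_simps)

text \<open>Induction on \<open>k\<close>, splitting \<open>1 - q\<^sup>k = (1 - q\<^bsup>k-j\<^esup>) + q\<^bsup>k-j\<^esup> (1 - q\<^sup>j)\<close> in the \<open>j\<close>-th term.\<close>

lemma bailey_kernel_sum:
  assumes q: "norm q < 1"
  shows "(\<Sum>j\<le>k. bailey_weight q d x j / (qpoch q q (k - j) * qpoch q q j * qpoch q q (j + d)))
    = qpoch x q k / (qpoch q q k * qpoch q q (k + d))"
proof (induction k arbitrary: d)
  case (Suc k)
  note nz = qpoch_qq_nonzero[OF q] one_minus_power_nonzero[OF q]
  let ?P = "qpoch q q"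
  \<comment> \<open>The identity is the q-Chu-Vandermonde sum with parameter q^(d+1)/x. Of the two
    pieces, \<open>u\<close> falls back to level \<open>k\<close> with the same \<open>d\<close>,
    and \<open>v\<close> to level \<open>k\<close> with \<open>d + 1\<close> and the index shifted
    by one; hence the induction with \<open>d\<close> arbitrary.\<close>
  define t where "t k d j = bailey_weight q d x j / (?P (k - j) * ?P j * ?P (j + d))" for k d j
  define u where "u j = (if j \<le> k then t k d j else 0)" for j
  define v where "v j = (if j = 0 then 0 else (q ^ (d + 1) - x) * q ^ k * t k (Suc d) (j - 1))" for j
  have split: "(1 - q ^ Suc k) * t (Suc k) d j = u j + v j" if j: "j \<le> Suc k" for j
  proof -
    obtain l where l: "Suc k = j + l" using le_Suc_ex[OF j] by blast
    have e: "1 - q ^ Suc k = (1 - q ^ l) + q ^ l * (1 - q ^ j)"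
      by (simp only: l power_add) (simp add: algebra_simps)
    have "(1 - q ^ l) * t (Suc k) d j = u j"
    proof (cases l)
      case 0
      with l show ?thesis by (simp add: u_def)
    next
      case (Suc l')
      then have "j \<le> k" "Suc k - j = Suc l'" "k - j = l'" using l by auto
      then show ?thesis using nz by (simp add: u_def t_def Suc qpoch_qq_Suc del: power_Suc)
    qed
    moreover have "q ^ l * (1 - q ^ j) * t (Suc k) d j = v j"
    proof (cases j)
      case 0
      then show ?thesis by (simp add: v_def)
    next
      case (Suc i)
      then have "k = l + i" "Suc k - j = l" "k - i = l" using l by auto
      then show ?thesis using nz bailey_weight_Suc_left[of q d x i]
        by (simp add: v_def t_def Suc qpoch_qq_Suc[of q i] power_add del: power_Suc) (simp add: mult_ac)
    qed
    ultimately show ?thesis unfolding e distrib_right by simp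
  qed
  have "(1 - q ^ Suc k) * (\<Sum>j\<le>Suc k. t (Suc k) d j) = (\<Sum>j\<le>Suc k. u j) + (\<Sum>j\<le>Suc k. v j)"
    unfolding sum_distrib_left sum.distrib[symmetric] by (intro sum.cong split) simp_all
  also have "(\<Sum>j\<le>Suc k. u j) = (\<Sum>j\<le>k. t k d j)"
    by (simp add: u_def)
  also have "(\<Sum>j\<le>Suc k. v j) = (q ^ (d + 1) - x) * q ^ k * (\<Sum>j\<le>k. t k (Suc d) j)"
    by (simp only: sum.atMost_Suc_shift) (simp add: v_def sum_distrib_left)
  also have "(\<Sum>j\<le>k. t k d j) = qpoch x q k / (?P k * ?P (k + d))"
    using Suc[of d] by (simp add: t_def)
  also have "(\<Sum>j\<le>k. t k (Suc d) j) = qpoch x q k / (?P k * ?P (k + Suc d))"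
    using Suc[of "Suc d"] by (simp add: t_def)
  also have "qpoch x q k / (?P k * ?P (k + d)) + (q ^ (d + 1) - x) * q ^ k
      * (qpoch x q k / (?P k * ?P (k + Suc d)))
     = (1 - q ^ Suc k) * (qpoch x q (Suc k) / (?P (Suc k) * ?P (Suc k + d)))"
    using nz(1)[of k] nz(1)[of "k + d"] nz(2)[of k] nz(2)[of "k + d"]
    by (simp add: qpoch_qq_Suc qpoch_Suc[of x] divide_simps del: power_Suc)
        (simp add: power_add algebra_simps)
  finally show ?case
    unfolding mult_cancel_left using nz(2)[of k] unfolding t_def by blast
qed simp

text \<open>The classical denominator \<open>(aq;q)\<^bsub>n+r\<^esub>\<close>, \<open>a = q\<^sup>s\<close>, is replaced by \<open>(q;q)\<^bsub>n+r+s\<^esub>\<close>, which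
  rescales \<open>\<alpha>\<close> by the constant factor \<open>(q;q)\<^sub>s\<close>.\<close>

definition bailey_pair :: "complex \<Rightarrow> nat \<Rightarrow> (nat \<Rightarrow> complex) \<Rightarrow> (nat \<Rightarrow> complex) \<Rightarrow> bool" where
  "bailey_pair q s \<alpha> \<beta> \<longleftrightarrow>
    (\<forall>n. \<beta> n = (\<Sum>r\<le>n. \<alpha> r / (qpoch q q (n - r) * qpoch q q (n + r + s))))"

text \<open>Bailey's lemma with one of its two parameters sent to infinity, multiplied through by
  \<open>qpoch x q m\<close> so that no product in \<open>x\<close> stands in a denominator.
  Inserting the pair and exchanging the sums leaves, for each \<open>r\<close>, the kernel sum with
  \<open>d = 2 * r + s\<close>.\<close>

lemma bailey_lemma:
  assumes q: "norm q < 1" and pair: "bailey_pair q s \<alpha> \<beta>"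
  shows "(\<Sum>n\<le>m. bailey_weight q s x n * \<beta> n / qpoch q q (m - n))
    = (\<Sum>r\<le>m. bailey_weight q s x r * qpoch (x * q ^ r) q (m - r) * \<alpha> r
         / (qpoch q q (m - r) * qpoch q q (m + r + s)))"
proof -
  let ?P = "qpoch q q"
  have "(\<Sum>n\<le>m. bailey_weight q s x n * \<beta> n / ?P (m - n))
     = (\<Sum>n\<le>m. \<Sum>r\<le>n. bailey_weight q s x n * \<alpha> r / (?P (m - n) * ?P (n - r) * ?P (n + r + s)))"
    using pair by (simp add: bailey_pair_def sum_distrib_left sum_divide_distrib mult_ac)
  also have "\<dots> = (\<Sum>r\<le>m. \<Sum>n=r..m. bailey_weight q s x n * \<alpha> r
      / (?P (m - n) * ?P (n - r) * ?P (n + r + s)))"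
    unfolding sum.Sigma[OF finite_atMost ballI[OF finite_atMost]] sum.Sigma[OF finite_atMost ballI[OF finite_atLeastAtMost]]
    by (rule sum.reindex_bij_witness[of _ prod.swap prod.swap]) auto
  also have "\<dots> = (\<Sum>r\<le>m. bailey_weight q s x r * qpoch (x * q ^ r) q (m - r) * \<alpha> r
         / (?P (m - r) * ?P (m + r + s)))"
  proof (rule sum.cong[OF refl])
    fix r assume "r \<in> {..m}"
    then obtain k where m: "m = r + k" using le_Suc_ex by auto
    have "(\<Sum>n=r..m. bailey_weight q s x n * \<alpha> r / (?P (m - n) * ?P (n - r) * ?P (n + r + s)))
       = (\<Sum>j\<le>k. bailey_weight q s x (r + j) * \<alpha> r / (?P (k - j) * ?P j * ?P (j + (2 * r + s))))"
      by (rule sum.reindex_bij_witness[of _ "\<lambda>j. r + j" "\<lambda>n. n - r"]) (auto simp: m algebra_simps mult_2)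
    also have "\<dots> = bailey_weight q s x r * \<alpha> r *
        (\<Sum>j\<le>k. bailey_weight q (2 * r + s) (x * q ^ r) j / (?P (k - j) * ?P j * ?P (j + (2 * r + s))))"
      by (simp add: bailey_weight_add sum_distrib_left mult_ac)
    also have "\<dots> = bailey_weight q s x r * qpoch (x * q ^ r) q k * \<alpha> r / (?P k * ?P (k + (2 * r + s)))"
      unfolding bailey_kernel_sum[OF q] by simp
    also have "k + (2 * r + s) = m + r + s" by (simp add: m)
    also have "k = m - r" by (simp add: m)
    finally show "(\<Sum>n=r..m. bailey_weight q s x n * \<alpha> r / (?P (m - n) * ?P (n - r) * ?P (n + r + s)))
      = bailey_weight q s x r * qpoch (x * q ^ r) q (m - r) * \<alpha> r / (?P (m - r) * ?P (m + r + s))" .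
  qed
  finally show ?thesis .
qed

text \<open>The case \<open>x = 0\<close>, where both parameters are infinite: the weights become
  pure powers of \<open>q\<close> and the product in \<open>x\<close> becomes 1.\<close>

lemma bailey_pair_step:
  assumes q: "norm q < 1" and pair: "bailey_pair q s \<alpha> \<beta>"
  shows "bailey_pair q s (\<lambda>r. q ^ (r ^ 2 + s * r) * \<alpha> r)
    (\<lambda>n. \<Sum>i\<le>n. q ^ (i ^ 2 + s * i) * \<beta> i / qpoch q q (n - i))"
  using bailey_lemma[OF assms, where x = 0] by (simp add: bailey_pair_def bailey_weight_zero)

text \<open>\<open>(1 - q\<^bsup>2r+1\<^esup>) = (1 - q\<^bsup>n+r+1\<^esup>) - q\<^bsup>2r+1\<^esup> (1 - q\<^bsup>n-r\<^esup>)\<close> splits every term of a pair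
  relative to \<open>a = q\<close> into two neighbouring terms of a pair relative to \<open>a = 1\<close>.\<close>

lemma bailey_pair_lower:
  assumes q: "norm q < 1" and pair: "bailey_pair q 1 (\<lambda>r. (1 - q ^ (2 * r + 1)) * \<gamma> r) \<beta>"
  shows "bailey_pair q 0 (\<lambda>r. case r of 0 \<Rightarrow> \<gamma> 0 | Suc i \<Rightarrow> \<gamma> r - q ^ (2 * i + 1) * \<gamma> i) \<beta>"
  unfolding bailey_pair_def
proof
  fix n
  note nz = qpoch_qq_nonzero[OF q] one_minus_power_nonzero[OF q]
  let ?P = "qpoch q q"
  define h where "h r = 1 / (?P (n - r) * ?P (n + r))" for r
  \<comment> \<open>At \<open>r = n\<close> the factor 1 - q^(n-r) vanishes, so \<open>v n\<close>
    must be 0. The formula alone need not give this, because \<open>h (Suc n)\<close> involves a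
    truncated subtraction.\<close>
  define v where "v r = (if r < n then q ^ (2 * r + 1) * \<gamma> r * h (Suc r) else 0)" for r
  have "\<beta> n = (\<Sum>r\<le>n. (1 - q ^ (2 * r + 1)) * \<gamma> r / (?P (n - r) * ?P (n + r + 1)))"
    using pair by (simp add: bailey_pair_def)
  also have "\<dots> = (\<Sum>r\<le>n. \<gamma> r * h r - v r)"
  proof (rule sum.cong[OF refl])
    fix r assume "r \<in> {..n}"
    then obtain k where n: "n = r + k" using le_Suc_ex by auto
    show "(1 - q ^ (2 * r + 1)) * \<gamma> r / (?P (n - r) * ?P (n + r + 1)) = \<gamma> r * h r - v r"
    proof (cases k)
      case 0
      then show ?thesis using nz(1)[of "2 * r"] nz(2)[of "2 * r"]
        by (simp add: n v_def h_def qpoch_qq_Suc mult_2[symmetric] divide_simps del: power_Suc)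
    next
      case (Suc l)
      have d: "n - r = Suc l" "n - Suc r = l" "n + Suc r = Suc (n + r)" by (simp_all add: n Suc)
      have "(1 - q ^ (2 * r + 1)) = (1 - q ^ Suc (n + r)) - q ^ (2 * r + 1) * (1 - q ^ Suc l)"
        by (simp add: n Suc power_add power_double algebra_simps)
      moreover have "(B - c * A) * \<gamma> r / (?P l * A * (?P (n + r) * B))
          = \<gamma> r * (1 / (?P l * A * ?P (n + r))) - c * \<gamma> r * (1 / (?P l * (?P (n + r) * B)))"
        if "A \<noteq> 0" "B \<noteq> 0" for A B c
        using that nz(1)[of l] nz(1)[of "n + r"] by (simp add: field_simps)
      moreover have "v r = q ^ (2 * r + 1) * \<gamma> r * h (Suc r)" by (simp add: v_def n Suc)
      ultimately show ?thesis
        using nz(2)[of l] nz(2)[of "n + r"]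
        by (simp only: h_def d qpoch_qq_Suc Suc_eq_plus1[symmetric] not_False_eq_True)
    qed
  qed
  also have "\<dots> = (\<Sum>r\<le>n. \<gamma> r * h r) - (\<Sum>r<n. v r)"
    by (simp add: sum_subtractf lessThan_Suc_atMost[symmetric]) (simp add: v_def)
  also have "\<dots> = (\<Sum>r\<le>n. (case r of 0 \<Rightarrow> \<gamma> 0 | Suc i \<Rightarrow> \<gamma> r - q ^ (2 * i + 1) * \<gamma> i) * h r)"
  proof (cases n)
    case (Suc l)
    have "(\<Sum>r<n. v r) = (\<Sum>r\<le>l. q ^ (2 * r + 1) * \<gamma> r * h (Suc r))"
      by (simp add: Suc v_def lessThan_Suc_atMost)
    then show ?thesis unfolding Suc sum.atMost_Suc_shift[of _ l]
      by (simp add: sum_subtractf algebra_simps)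
  qed simp
  finally show "\<beta> n = (\<Sum>r\<le>n. (case r of 0 \<Rightarrow> \<gamma> 0 | Suc i \<Rightarrow> \<gamma> r - q ^ (2 * i + 1) * \<gamma> i) /
      (?P (n - r) * ?P (n + r + 0)))"
    by (simp add: h_def)
qed

text \<open>Serves twice: up to the factor \<open>1 - q ^ (2 * r + 1)\<close> it is the alpha of the
  unit Bailey pair for \<open>a = q\<close>, and with base \<open>a * b\<close> it gives the
  coefficients of the theta series.\<close>

definition unit_seq :: "complex \<Rightarrow> nat \<Rightarrow> complex" where
  "unit_seq q r = (- 1) ^ r * q ^ (r choose 2)"

lemma unit_seq_Suc: "unit_seq q (Suc r) = - (q ^ r) * unit_seq q r"
  by (simp add: unit_seq_def numeral_2_eq_2 power_add)

text \<open>The sum telescopes, since its partial sums have a closed form. Only \<open>a = q\<close>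
  is treated; the unit pair for \<open>a = 1\<close> follows with
  \<open>bailey_pair_lower\<close>.\<close>

lemma unit_bailey_pair:
  assumes q: "norm q < 1"
  shows "bailey_pair q 1 (\<lambda>r. (1 - q ^ (2 * r + 1)) * unit_seq q r) (\<lambda>n. if n = 0 then 1 else 0)"
  unfolding bailey_pair_def
proof
  fix n
  note nz = qpoch_qq_nonzero[OF q] one_minus_power_nonzero[OF q]
  let ?P = "qpoch q q"
  let ?t = "\<lambda>r. (1 - q ^ (2 * r + 1)) * unit_seq q r / (?P (n - r) * ?P (n + r + 1))"
  show "(if n = 0 then 1 else 0) = (\<Sum>r\<le>n. ?t r)"
  proof (cases n)
    case 0
    then show ?thesis using nz(2)[of 0] by (simp add: unit_seq_def qpoch_Suc numeral_2_eq_2)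
  next
    case (Suc m)
    \<comment> \<open>The factor \<open>1 - q ^ n\<close> is the denominator of the closed form, and
      is nonzero only for \<open>n > 0\<close>. The formula stops at \<open>R = n\<close>, beyond
      which \<open>n - R\<close> truncates, so the summand \<open>r = n\<close> is cancelled
      separately at the end.\<close>
    have partial: "(\<Sum>r<R. ?t r) * (1 - q ^ n) = - unit_seq q R * (1 - q ^ R) / (?P (n - R) * ?P (n + R))"
      if "R \<le> n" for R
      using that
    proof (induction R)
      case (Suc R)
      then obtain k where n: "n = R + Suc k"
        by (metis Suc_leD add_Suc_right le_Suc_ex add_Suc)
      have d: "n - R = Suc k" "n - Suc R = k" "n + Suc R = Suc (n + R)" "n + R + 1 = Suc (n + R)"
        by (simp_all add: n)
      have e: "?P (Suc k) = ?P k * (1 - q ^ Suc k)" "?P (Suc (n + R)) = ?P (n + R)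
          * (1 - q ^ Suc (n + R))"
        by (rule qpoch_qq_Suc)+
      have IH: "(\<Sum>r<R. ?t r) * (1 - q ^ n) = - unit_seq q R * (1 - q ^ R) / (?P (n - R) * ?P (n + R))"
        using Suc by simp
      \<comment> \<open>This factorisation drives the telescoping: \<open>q ^ R\<close> turns
        \<open>unit_seq q R\<close> into \<open>- unit_seq q (Suc R)\<close>, and
        \<open>1 - q ^ Suc k\<close> lowers \<open>n - R\<close> to
        \<open>n - Suc R\<close>.\<close>
      have id: "(1 - q ^ (2 * R + 1)) * (1 - q ^ n) - (1 - q ^ R) * (1 - q ^ Suc (n + R))
         = q ^ R * (1 - q ^ Suc R) * (1 - q ^ Suc k)"
        by (simp add: n power_add power_double algebra_simps)
      have "(\<Sum>r<Suc R. ?t r) * (1 - q ^ n) = unit_seq q R *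
          ((1 - q ^ (2 * R + 1)) * (1 - q ^ n) - (1 - q ^ R) * (1 - q ^ Suc (n + R)))
          / (?P k * (1 - q ^ Suc k) * (?P (n + R) * (1 - q ^ Suc (n + R))))"
        unfolding sum.lessThan_Suc distrib_right IH unfolding d e
        using nz(1)[of k] nz(1)[of "n + R"] nz(2)[of k] nz(2)[of "n + R"]
        by (simp add: divide_simps del: power_Suc) (simp add: algebra_simps)
      also have "\<dots> = - unit_seq q (Suc R) * (1 - q ^ Suc R) / (?P (n - Suc R) * ?P (n + Suc R))"
        unfolding id d e unit_seq_Suc
        using nz(1)[of k] nz(1)[of "n + R"] nz(2)[of k] nz(2)[of "n + R"]
        by (simp add: divide_simps del: power_Suc)
      finally show ?case .
    qed simp
    have "?t n * (1 - q ^ n) = unit_seq q n * (1 - q ^ n) / ?P (n + n)"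
      using nz(1)[of "n + n"] nz(2)[of "n + n"]
      by (simp add: qpoch_qq_Suc divide_simps mult_2 del: power_Suc)
    then have "(\<Sum>r\<le>n. ?t r) * (1 - q ^ n) = 0"
      using partial[of n] by (simp add: lessThan_Suc_atMost[symmetric] distrib_right)
    then show ?thesis using Suc nz(2)[of m] by simp
  qed
qed

section \<open>The limiting form of Bailey's lemma\<close>

lemma summable_norm_bailey_weight:
  assumes "norm q < 1"
  shows "summable (\<lambda>n. norm (bailey_weight q s x n))"
  unfolding bailey_weight_def
proof (rule summable_norm_prod)
  have "(\<lambda>i. q ^ i * (q ^ (s + 1) * q ^ i - x)) \<longlonglongrightarrow> 0 * (q ^ (s + 1) * 0 - x)"
    by (intro tendsto_intros LIMSEQ_power_zero assms)
  then show "(\<lambda>i. q ^ i * (q ^ (s + 1 + i) - x)) \<longlonglongrightarrow> 0"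
    by (simp add: power_add mult_ac)
qed

text \<open>Lets \<open>m\<close> tend to infinity in \<open>bailey_lemma\<close>, with Tannery's
  theorem on both sides. The weights are absolutely summable, so bounds on alpha and beta give the
  domination.\<close>

lemma bailey_limit:
  assumes q: "norm q < 1" and pair: "bailey_pair q s \<alpha> \<beta>"
    and A: "\<And>r. norm (\<alpha> r) \<le> A" and B: "\<And>n. norm (\<beta> n) \<le> B"
    and S: "(\<lambda>r. bailey_weight q s x r * qpoch_inf (x * q ^ r) q * \<alpha> r) sums S"
  shows "(\<lambda>n. bailey_weight q s x n * \<beta> n) sums (S / qpoch_inf q q)"
proof -
  let ?P = "qpoch q q" and ?I = "qpoch_inf q q" and ?w = "bailey_weight q s x"
  obtain K where K: "0 < K" "\<And>n. norm (1 / ?P n) \<le> K"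
    using inverse_qpoch_bounded[OF q] by blast
  note I = qpoch_inf_qq_nonzero[OF q]
  note w = summable_norm_bailey_weight[OF q, of s x]
  define E where "E = exp (norm x / (1 - norm q))"
  have P1: "(\<lambda>m. ?P (m - k)) \<longlonglongrightarrow> ?I" for k
    by (rule LIMSEQ_offset[of _ k]) (simp add: qpoch_tendsto q)
  have P2: "(\<lambda>m. ?P (m + r + s)) \<longlonglongrightarrow> ?I" for r
    using LIMSEQ_ignore_initial_segment[OF qpoch_tendsto[OF q, of q], of "r + s"] by
        (simp add: add.assoc)
  have P3: "(\<lambda>m. qpoch (x * q ^ r) q (m - r)) \<longlonglongrightarrow> qpoch_inf (x * q ^ r) q" for r
    by (rule LIMSEQ_offset[of _ r]) (simp add: qpoch_tendsto q)
  have lhs: "(\<lambda>m. \<Sum>n\<le>m. ?w n * \<beta> n / ?P (m - n)) \<longlonglongrightarrow> (\<Sum>n. ?w n * \<beta> n / ?I)"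
    "summable (\<lambda>n. ?w n * \<beta> n / ?I)"
  \<comment> \<open>Both conclusions, the limit and the summability, are wanted here, so every
    premise arises twice.\<close>
  proof (rule_tac [!] tannery_triangular[where M = "\<lambda>n. norm (?w n) * (B * K)"])
    show "(\<lambda>m. ?w k * \<beta> k / ?P (m - k)) \<longlonglongrightarrow> ?w k * \<beta> k / ?I"
        "(\<lambda>m. ?w k * \<beta> k / ?P (m - k)) \<longlonglongrightarrow> ?w k * \<beta> k / ?I" for k
      by (intro tendsto_intros P1 I)+
    have "norm (?w k * (\<beta> k * (1 / ?P (m - k)))) \<le> norm (?w k) * (B * K)" for k m
      unfolding norm_mult
      by (intro mult_left_mono mult_mono B K) (use order_trans[OF norm_ge_zero B] in auto)
    then show "norm (?w k * \<beta> k / ?P (m - k)) \<le> norm (?w k) * (B * K)"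
        "norm (?w k * \<beta> k / ?P (m - k)) \<le> norm (?w k) * (B * K)" for k m
      by simp_all
  qed (intro summable_mult2 w)+
  have rhs: "(\<lambda>m. \<Sum>r\<le>m. ?w r * qpoch (x * q ^ r) q (m - r) * \<alpha> r / (?P (m - r) * ?P (m + r + s)))
     \<longlonglongrightarrow> (\<Sum>r. ?w r * qpoch_inf (x * q ^ r) q * \<alpha> r / (?I * ?I))"
  proof (rule tannery_triangular[where M = "\<lambda>n. norm (?w n) * (E * (A * (K * K)))"])
    show "(\<lambda>m. ?w r * qpoch (x * q ^ r) q (m - r) * \<alpha> r / (?P (m - r) * ?P (m + r + s)))
      \<longlonglongrightarrow> ?w r * qpoch_inf (x * q ^ r) q * \<alpha> r / (?I * ?I)" for r
      using I by (intro tendsto_intros P1 P2 P3) simp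
    fix r m
    have "norm (x * q ^ r) \<le> norm x"
      using q by (simp add: norm_mult norm_power mult_left_le power_le_one)
    then have "norm (qpoch (x * q ^ r) q (m - r)) \<le> E"
      using q by (intro order_trans[OF qpoch_norm_le]) (simp_all add: E_def divide_right_mono)
    then have "norm (?w r * (qpoch (x * q ^ r) q (m - r)
        * (\<alpha> r * (1 / ?P (m - r) * (1 / ?P (m + r + s))))))
       \<le> norm (?w r) * (E * (A * (K * K)))"
      unfolding norm_mult
      by (intro mult_left_mono mult_mono A K) (use order_trans[OF norm_ge_zero A] K(1) in \<open>auto simp: E_def\<close>)
    then show "norm (?w r * qpoch (x * q ^ r) q (m - r) * \<alpha> r / (?P (m - r) * ?P (m + r + s)))
       \<le> norm (?w r) * (E * (A * (K * K)))"
      by (simp add: mult.assoc)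
  qed (intro summable_mult2 w)
  have "(\<Sum>n. ?w n * \<beta> n / ?I) = (\<Sum>r. ?w r * qpoch_inf (x * q ^ r) q * \<alpha> r / (?I * ?I))"
    using LIMSEQ_unique lhs(1) rhs unfolding bailey_lemma[OF q pair] by blast
  also have "\<dots> = S / (?I * ?I)"
    using sums_divide[OF S] by (simp add: sums_iff)
  finally have "(\<lambda>n. ?w n * \<beta> n / ?I) sums (S / (?I * ?I))"
    using lhs(2) by (simp add: sums_iff)
  \<comment> \<open>The left side carries \<open>1 / ?I\<close> and the right side
    \<open>1 / (?I * ?I)\<close>; one factor survives.\<close>
  from sums_mult2[OF this, of ?I] show ?thesis using I by simp
qed

subsection \<open>The Jacobi triple product\<close>

text \<open>The general term (-1)^i a^(i(i+1)/2) b^(i(i-1)/2) of Ramanujan's theta function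
  f(-a,-b). The split on the sign of \<open>i\<close> keeps all exponents natural, so that
  \<open>a\<close> or \<open>b\<close> may be 0.\<close>

definition theta_term :: "complex \<Rightarrow> complex \<Rightarrow> int \<Rightarrow> complex" where
  "theta_term a b i = (if 0 \<le> i then unit_seq (a * b) (nat i) * a ^ nat i
     else unit_seq (a * b) (nat (- i)) * b ^ nat (- i))"

lemma unit_seq_0 [simp]: "unit_seq q 0 = 1"
  by (simp add: unit_seq_def numeral_2_eq_2)

lemma theta_term_of_nat: "theta_term a b (int r) = unit_seq (a * b) r * a ^ r"
  by (simp add: theta_term_def)

lemma theta_term_uminus: "theta_term a b (- i) = theta_term b a i"
  by (auto simp: theta_term_def mult.commute)

text \<open>Consecutive terms have ratio -a (ab)^i. Multiplying by (ab)^(n-i) removes negative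
  powers, and \<open>i \<le> int n\<close> makes that exponent natural.\<close>

lemma theta_term_step:
  assumes "i \<le> int n"
  shows "a * (a * b) ^ n * theta_term a b i = - ((a * b) ^ nat (int n - i) * theta_term a b (i + 1))"
proof (cases "0 \<le> i")
  case True
  then obtain r where r: "i = int r" by (metis nonneg_int_cases)
  with assms obtain k where n: "n = r + k" using le_Suc_ex by auto
  have "theta_term a b (i + 1) = unit_seq (a * b) (Suc r) * a ^ Suc r"
    using theta_term_of_nat[of a b "Suc r"] by (simp add: r add.commute)
  then show ?thesis
    by (simp add: r n theta_term_of_nat unit_seq_Suc power_add mult_ac)
next
  case False
  then obtain k where k: "i = - int (Suc k)"
    by (metis negD not_le)
  have e: "theta_term a b (i + 1) = unit_seq (a * b) k * b ^ k"
    using theta_term_uminus[of a b "int k"] by (simp add: k theta_term_of_nat mult.commute)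
  have "theta_term a b i = unit_seq (a * b) (Suc k) * b ^ Suc k"
    using theta_term_uminus[of a b "int (Suc k)"] by (simp only: k theta_term_of_nat mult.commute)
  moreover have "nat (int n - i) = n + Suc k" by (simp add: k)
  ultimately show ?thesis unfolding e by (simp add: unit_seq_Suc power_add mult_ac)
qed

text \<open>Raising \<open>n\<close> appends the factor 1 - a (ab)^n to the product. On the sum side
  this is a q-Pascal rule, in which \<open>theta_term_step\<close> shifts the index. It is stated on
  its own because it is also used with \<open>a\<close> and \<open>b\<close> exchanged.\<close>

lemma finite_triple_product_step:
  assumes Q: "norm (a * b) < 1"
    and IH: "(\<Sum>k\<le>m + n. theta_term a b (int k - int m)
        / (qpoch (a * b) (a * b) k * qpoch (a * b) (a * b) (m + n - k)))
      = qpoch b (a * b) m * qpoch a (a * b) n / qpoch (a * b) (a * b) (m + n)"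
  shows "(\<Sum>k\<le>m + Suc n. theta_term a b (int k - int m)
      / (qpoch (a * b) (a * b) k * qpoch (a * b) (a * b) (m + Suc n - k)))
      = qpoch b (a * b) m * qpoch a (a * b) (Suc n) / qpoch (a * b) (a * b) (m + Suc n)"
proof -
  define q where "q = a * b"
  note nz = qpoch_qq_nonzero[OF Q, folded q_def] one_minus_power_nonzero[OF Q, folded q_def]
  define N where "N = m + n"
  define t where "t k = theta_term a b (int k - int m)" for k
  let ?P = "qpoch q q"
  define u where "u k = (if k \<le> N then t k / (?P k * ?P (N - k)) else 0)" for k
  define v where "v k = (if k = 0 then 0 else q ^ (Suc N - k) * t k
      / (?P (k - 1) * ?P (Suc N - k)))" for k
  have split: "u k + v k = (1 - q ^ Suc N) * (t k / (?P k * ?P (Suc N - k)))" if k: "k \<le> Suc N" for k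
  proof -
    obtain l where l: "Suc N = k + l" using le_Suc_ex[OF k] by blast
    have e: "1 - q ^ Suc N = (1 - q ^ l) + q ^ l * (1 - q ^ k)"
      by (simp only: l power_add) (simp add: algebra_simps)
    have "(1 - q ^ l) * (t k / (?P k * ?P (Suc N - k))) = u k"
    proof (cases l)
      case 0
      with l show ?thesis by (simp add: u_def)
    next
      case (Suc l')
      then have "k \<le> N" "Suc N - k = Suc l'" "N - k = l'" using l by auto
      then show ?thesis using nz by (simp add: u_def Suc qpoch_qq_Suc del: power_Suc)
    qed
    moreover have "q ^ l * (1 - q ^ k) * (t k / (?P k * ?P (Suc N - k))) = v k"
    proof (cases k)
      case 0
      then show ?thesis by (simp add: v_def)
    next
      case (Suc i)
      then have "Suc N - k = l" using l by auto
      then show ?thesis using nz by (simp add: v_def Suc qpoch_qq_Suc[of q i] del: power_Suc)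
    qed
    ultimately show ?thesis unfolding e distrib_right by simp
  qed
  have "(1 - a * q ^ n) * (\<Sum>k\<le>N. t k / (?P k * ?P (N - k)))
     = (\<Sum>k\<le>N. t k / (?P k * ?P (N - k))) + (\<Sum>k\<le>N. - (a * q ^ n * t k) / (?P k * ?P (N - k)))"
    by (simp add: left_diff_distrib sum_distrib_left sum_subtractf sum_negf diff_divide_distrib)
  also have "(\<Sum>k\<le>N. - (a * q ^ n * t k) / (?P k * ?P (N - k))) = (\<Sum>k\<le>N. v (Suc k))"
  proof (rule sum.cong[OF refl])
    fix k assume "k \<in> {..N}"
    then have "int k - int m \<le> int n" "nat (int n - (int k - int m)) = N - k" by (auto simp: N_def)
    then have "a * q ^ n * t k = - (q ^ (N - k) * t (Suc k))"
      using theta_term_step[of "int k - int m" n a b]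
      by (simp add: t_def q_def algebra_simps)
    then show "- (a * q ^ n * t k) / (?P k * ?P (N - k)) = v (Suc k)"
      by (simp add: v_def)
  qed
  also have "\<dots> = (\<Sum>k\<le>Suc N. v k)"
    by (simp only: sum.atMost_Suc_shift) (simp add: v_def)
  also have "(\<Sum>k\<le>N. t k / (?P k * ?P (N - k))) = (\<Sum>k\<le>Suc N. u k)"
    by (simp add: u_def)
  also have "(\<Sum>k\<le>Suc N. u k) + (\<Sum>k\<le>Suc N. v k) = (1 - q ^ Suc N)
      * (\<Sum>k\<le>Suc N. t k / (?P k * ?P (Suc N - k)))"
    unfolding sum_distrib_left sum.distrib[symmetric] by (intro sum.cong split) simp_all
  finally have "(1 - a * q ^ n) * (\<Sum>k\<le>Suc N. u k)
     = (1 - q ^ Suc N) * (\<Sum>k\<le>Suc N. t k / (?P k * ?P (Suc N - k)))" .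
  moreover have "(\<Sum>k\<le>Suc N. u k) = qpoch b q m * qpoch a q n / ?P N"
    using IH by (simp add: u_def t_def N_def q_def)
  ultimately have "(\<Sum>k\<le>Suc N. t k / (?P k * ?P (Suc N - k)))
     = (1 - a * q ^ n) * (qpoch b q m * qpoch a q n / ?P N) / (1 - q ^ Suc N)"
    unfolding nonzero_eq_divide_eq[OF nz(2)] by (simp only: mult.commute)
  also have "\<dots> = qpoch b q m * qpoch a q (Suc n) / ?P (Suc N)"
    unfolding qpoch_Suc[of a] qpoch_qq_Suc by simp
  finally have "(\<Sum>k\<le>Suc N. t k / (?P k * ?P (Suc N - k))) = qpoch b q m * qpoch a q (Suc n)
      / ?P (Suc N)" .
  then show ?thesis by (simp add: t_def N_def q_def)
qed

lemma finite_triple_product: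
  assumes Q: "norm (a * b) < 1"
  shows "(\<Sum>k\<le>m + n. theta_term a b (int k - int m)
      / (qpoch (a * b) (a * b) k * qpoch (a * b) (a * b) (m + n - k)))
      = qpoch b (a * b) m * qpoch a (a * b) n / qpoch (a * b) (a * b) (m + n)"
proof (induction n)
  case 0
  let ?P = "qpoch (a * b) (a * b)"
  have Q': "norm (b * a) < 1" using Q by (simp add: mult.commute)
  \<comment> \<open>For \<open>n = 0\<close>, \<open>m\<close> is built up from 0 by the same step
    with \<open>a\<close> and \<open>b\<close> exchanged. Reversing the order of summation then
    restores their roles.\<close>
  have "(\<Sum>k\<le>0 + m. theta_term b a (int k - int 0)
      / (qpoch (b * a) (b * a) k * qpoch (b * a) (b * a) (0 + m - k)))
      = qpoch a (b * a) 0 * qpoch b (b * a) m / qpoch (b * a) (b * a) (0 + m)"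
    by (induction m) (simp add: theta_term_def, rule finite_triple_product_step[OF Q'])
  moreover have "(\<Sum>k\<le>m. theta_term a b (int k - int m) / (?P k * ?P (m - k)))
     = (\<Sum>k\<le>m. theta_term b a (int k) / (?P k * ?P (m - k)))"
  proof (rule sum.reindex_bij_witness[of _ "\<lambda>k. m - k" "\<lambda>k. m - k"])
    fix k assume "k \<in> {..m}"
    then have "int k - int m = - int (m - k)" "m - (m - k) = k" by auto
    then show "theta_term b a (int (m - k)) / (?P (m - k) * ?P (m - (m - k)))
        = theta_term a b (int k - int m) / (?P k * ?P (m - k))"
      by (simp only: theta_term_uminus mult.commute)
  qed auto
  ultimately show ?case by (simp add: mult.commute)
next
  case (Suc n)
  then show ?case by (rule finite_triple_product_step[OF Q])
qed

lemma summable_norm_unit_seq: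
  assumes "norm q < 1"
  shows "summable (\<lambda>r. norm (unit_seq q r * a ^ r))"
proof -
  have "(\<lambda>i. - (q ^ i) * a) \<longlonglongrightarrow> - 0 * a"
    by (intro tendsto_intros LIMSEQ_power_zero assms)
  then have "summable (\<lambda>r. norm (\<Prod>i<r. - (q ^ i) * a))"
    by (intro summable_norm_prod) simp
  moreover have "(\<Prod>i<r. - (q ^ i) * a) = unit_seq q r * a ^ r" for r
    by (induction r) (simp_all add: unit_seq_Suc)
  ultimately show ?thesis by simp
qed

text \<open>Takes \<open>m = n\<close> to infinity in the finite form. The two-sided series is cut
  at its centre into two one-sided ones, and the central term 1 is counted in both; hence the
  \<open>1 +\<close>.\<close>

lemma triple_product:
  assumes Q: "norm (a * b) < 1"
  shows "(\<Sum>r. unit_seq (a * b) r * a ^ r) + (\<Sum>r. unit_seq (a * b) r * b ^ r)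
    = 1 + qpoch_inf a (a * b) * qpoch_inf b (a * b) * qpoch_inf (a * b) (a * b)"
proof -
  define q where "q = a * b"
  have q: "norm q < 1" using Q by (simp add: q_def)
  let ?P = "qpoch q q" and ?I = "qpoch_inf q q"
  obtain K where K: "0 < K" "\<And>n. norm (1 / ?P n) \<le> K"
    using inverse_qpoch_bounded[OF q] by blast
  note I = qpoch_inf_qq_nonzero[OF q]
  have P1: "(\<lambda>m. ?P (m - k)) \<longlonglongrightarrow> ?I" for k
    by (rule LIMSEQ_offset[of _ k]) (simp add: qpoch_tendsto q)
  have P2: "(\<lambda>m. ?P (m + r)) \<longlonglongrightarrow> ?I" for r
    using LIMSEQ_ignore_initial_segment[OF qpoch_tendsto[OF q, of q], of r] by simp
  have half: "(\<lambda>n. \<Sum>r\<le>n. unit_seq q r * c ^ r / (?P (n - r) * ?P (n + r)))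
     \<longlonglongrightarrow> (\<Sum>r. unit_seq q r * c ^ r) / (?I * ?I)" for c
  proof -
    have "(\<lambda>n. \<Sum>r\<le>n. unit_seq q r * c ^ r / (?P (n - r) * ?P (n + r)))
     \<longlonglongrightarrow> (\<Sum>r. unit_seq q r * c ^ r / (?I * ?I))"
    proof (rule tannery_triangular[where M = "\<lambda>r. norm (unit_seq q r * c ^ r) * (K * K)"])
      show "(\<lambda>n. unit_seq q r * c ^ r / (?P (n - r) * ?P (n + r))) \<longlonglongrightarrow> unit_seq q r * c ^ r
          / (?I * ?I)" for r
        using I by (intro tendsto_intros P1 P2) simp
      fix r n
      have "norm (unit_seq q r * c ^ r * (1 / ?P (n - r) * (1 / ?P (n + r))))
          \<le> norm (unit_seq q r * c ^ r) * (K * K)"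
        unfolding norm_mult[of _ "1 / ?P (n - r) * (1 / ?P (n + r))"] norm_mult[of "1 / ?P (n - r)"]
        using K by (intro mult_left_mono mult_mono) auto
      then show "norm (unit_seq q r * c ^ r / (?P (n - r) * ?P (n + r)))
          \<le> norm (unit_seq q r * c ^ r) * (K * K)"
        by simp
    qed (intro summable_mult2 summable_norm_unit_seq q)
    then show ?thesis
      using suminf_divide[OF summable_norm_cancel[OF summable_norm_unit_seq[OF q]], of c "?I * ?I"]
          by simp
  qed
  have fin: "(\<Sum>r\<le>n. unit_seq q r * a ^ r / (?P (n - r) * ?P (n + r)))
      + (\<Sum>r\<le>n. unit_seq q r * b ^ r / (?P (n - r) * ?P (n + r)))
      = qpoch b q n * qpoch a q n / ?P (n + n) + 1 / (?P n * ?P n)" for n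
  proof -
    define f where "f k = theta_term a b (int k - int n) / (?P k * ?P (n + n - k))" for k
    have "(\<Sum>k\<le>n + j. f k) + f n = (\<Sum>k\<le>n. f k) + (\<Sum>r\<le>j. f (n + r))" for j
      by (induction j) simp_all
    from this[of n] have "(\<Sum>k\<le>n + n. f k) + f n = (\<Sum>k\<le>n. f k) + (\<Sum>r\<le>n. f (n + r))" .
    moreover have "(\<Sum>k\<le>n + n. f k) = qpoch b q n * qpoch a q n / ?P (n + n)"
      using finite_triple_product[OF Q, of n n] by (simp add: f_def q_def)
    moreover have "f n = 1 / (?P n * ?P n)"
      by (simp add: f_def theta_term_def)
    moreover have "(\<Sum>r\<le>n. f (n + r)) = (\<Sum>r\<le>n. unit_seq q r * a ^ r / (?P (n - r) * ?P (n + r)))"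
      by (simp add: f_def theta_term_of_nat q_def mult.commute)
    moreover have "(\<Sum>k\<le>n. f k) = (\<Sum>r\<le>n. unit_seq q r * b ^ r / (?P (n - r) * ?P (n + r)))"
    proof (rule sum.reindex_bij_witness[of _ "\<lambda>k. n - k" "\<lambda>k. n - k"])
      fix k assume "k \<in> {..n}"
      then have "int k - int n = - int (n - k)" "n - (n - k) = k" "n + (n - k) = n + n - k" by auto
      then show "unit_seq q (n - k) * b ^ (n - k) / (?P (n - (n - k)) * ?P (n + (n - k))) = f k"
        by (simp only: f_def theta_term_uminus theta_term_of_nat q_def mult.commute)
    qed auto
    ultimately show ?thesis by (simp add: add.commute)
  qed
  have "(\<lambda>n. qpoch b q n * qpoch a q n / ?P (n + n) + 1 / (?P n * ?P n))
      \<longlonglongrightarrow> (\<Sum>r. unit_seq q r * a ^ r) / (?I * ?I) + (\<Sum>r. unit_seq q r * b ^ r) / (?I * ?I)"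
    using tendsto_add[OF half[of a] half[of b]] unfolding fin .
  moreover have "(\<lambda>n. ?P (n + n)) \<longlonglongrightarrow> ?I"
    by (rule filterlim_compose[OF qpoch_tendsto[OF q]]) (intro filterlim_subseq strict_monoI, simp)
  then have "(\<lambda>n. qpoch b q n * qpoch a q n / ?P (n + n) + 1 / (?P n * ?P n))
      \<longlonglongrightarrow> qpoch_inf b q * qpoch_inf a q / ?I + 1 / (?I * ?I)"
    using I by (intro tendsto_intros qpoch_tendsto q) simp_all
  ultimately have "(\<Sum>r. unit_seq q r * a ^ r) / (?I * ?I) + (\<Sum>r. unit_seq q r * b ^ r) / (?I * ?I)
      = qpoch_inf b q * qpoch_inf a q / ?I + 1 / (?I * ?I)"
    by (rule LIMSEQ_unique)
  then have "(\<Sum>r. unit_seq q r * a ^ r) + (\<Sum>r. unit_seq q r * b ^ r) = 1 + qpoch_inf a q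
      * qpoch_inf b q * ?I"
    using I by (simp add: field_simps)
  then show ?thesis by (simp add: q_def)
qed

text \<open>Two ways to fold the two-sided series: the first pairs index \<open>r\<close> with -r,
  the second with -(r+1). They fit the alphas of pairs relative to \<open>a = 1\<close> and
  \<open>a = q\<close> respectively.\<close>

lemma triple_product_sums:
  assumes q: "norm q < 1" and ab: "a * b = q"
  shows "(\<lambda>r. case r of 0 \<Rightarrow> 1 | Suc _ \<Rightarrow> unit_seq q r * (a ^ r + b ^ r))
      sums (qpoch_inf a q * qpoch_inf b q * qpoch_inf q q)" (is "?f sums ?S")
    and "(\<lambda>r. unit_seq q r * (a ^ r - q ^ r * b ^ Suc r))
      sums (qpoch_inf a q * qpoch_inf b q * qpoch_inf q q)" (is "?g sums _")
proof -
  let ?t = "\<lambda>c r. unit_seq q r * c ^ r"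
  have t: "?t c sums (\<Sum>r. ?t c r)" for c
    by (intro summable_sums summable_norm_cancel[OF summable_norm_unit_seq] q)
  have b: "(\<lambda>r. ?t b (Suc r)) sums ((\<Sum>r. ?t b r) - 1)"
    using t[of b] by (subst sums_Suc_iff) simp
  have a: "(\<lambda>r. ?t a (Suc r)) sums ((\<Sum>r. ?t a r) - 1)"
    using t[of a] by (subst sums_Suc_iff) simp
  have S: "(\<Sum>r. ?t a r) + ((\<Sum>r. ?t b r) - 1) = ?S"
    using triple_product[of a b] q unfolding ab by (simp only: add_diff_eq) simp
  have "(\<lambda>r. ?f (Suc r)) sums (?S - 1)"
    using sums_add[OF a b] S by (simp add: algebra_simps del: power_Suc)
  then show "?f sums ?S"
    by (subst (asm) sums_Suc_iff) simp
  show "?g sums ?S"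
    using sums_add[OF t[of a] b] unfolding S by (simp add: unit_seq_Suc algebra_simps)
qed

subsection \<open>The double sums\<close>

lemma iterated_bailey_pair:
  assumes q: "norm q < 1" and pair: "bailey_pair q s \<alpha> (\<lambda>n. if n = 0 then 1 else 0)"
  shows "bailey_pair q s (\<lambda>r. q ^ (2 * (r ^ 2 + s * r)) * \<alpha> r)
    (\<lambda>n. \<Sum>i\<le>n. q ^ (i ^ 2 + s * i) / (qpoch q q i * qpoch q q (n - i)))"
proof -
  \<comment> \<open>Only \<open>i = 0\<close> contributes, so one step of the chain turns the unit
    beta into the reciprocal of (q;q)_n.\<close>
  have "(\<Sum>i\<le>n. q ^ (i ^ 2 + s * i) * (if i = 0 then 1 else 0) / qpoch q q (n - i)) = 1
      / qpoch q q n" for n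
    by (subst sum.remove[of _ 0]) simp_all
  with bailey_pair_step[OF q bailey_pair_step[OF q pair]] show ?thesis
    by (simp add: power_double mult.assoc del: distrib_left_numeral)
qed

text \<open>The exponent \<open>i ^ 2 + s * i\<close> is at least \<open>i\<close>, so a geometric
  series bounds the sum uniformly in \<open>n\<close>.\<close>

lemma iterated_beta_bounded:
  assumes q: "norm q < 1"
  obtains B where "\<And>n. norm (\<Sum>i\<le>n. q ^ (i ^ 2 + s * i) / (qpoch q q i * qpoch q q (n - i))) \<le> B"
proof -
  obtain K where K: "0 < K" "\<And>n. norm (1 / qpoch q q n) \<le> K"
    using inverse_qpoch_bounded[OF q] by blast
  have "norm (\<Sum>i\<le>n. q ^ (i ^ 2 + s * i) / (qpoch q q i * qpoch q q (n - i))) \<le> 1 / (1 - norm q)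
      * (K * K)" for n
  proof -
    have "norm (q ^ (i ^ 2 + s * i) * (1 / qpoch q q i * (1 / qpoch q q (n - i)))) \<le> norm q ^ i
        * (K * K)" for i
      unfolding norm_mult norm_power
    proof (intro mult_mono K)
      have "i \<le> i ^ 2 + s * i" by (simp add: power2_eq_square trans_le_add1)
      then show "norm q ^ (i ^ 2 + s * i) \<le> norm q ^ i" using q by (intro power_decreasing) auto
    qed (use K in auto)
    then have "norm (\<Sum>i\<le>n. q ^ (i ^ 2 + s * i) / (qpoch q q i * qpoch q q (n - i)))
        \<le> (\<Sum>i\<le>n. norm q ^ i * (K * K))"
      by (intro sum_norm_le) simp
    also have "\<dots> = (\<Sum>i\<le>n. norm q ^ i) * (K * K)" by (simp add: sum_distrib_right)
    also have "(\<Sum>i\<le>n. norm q ^ i) \<le> (\<Sum>i. norm q ^ i)"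
      using q by (intro sum_le_suminf) auto
    also have "(\<Sum>i. norm q ^ i) = 1 / (1 - norm q)" using q by (simp add: suminf_geometric)
    finally show ?thesis using K(1) by (simp add: mult_right_mono)
  qed
  then show ?thesis by (rule that)
qed

lemma sum_qbinom_eq:
  "(\<Sum>i=0..n. f i * qbinom q n i) = qpoch q q n * (\<Sum>i\<le>n. f i / (qpoch q q i * qpoch q q (n - i)))"
  unfolding sum_distrib_left atMost_atLeast0 by (intro sum.cong) (auto simp: qbinom_def)

text \<open>The inner sum has parameter \<open>t\<close>, the outer weight \<open>s\<close>. They
  are kept apart for the fourth identity, where \<open>t = 1\<close> and
  \<open>s = 0\<close>.\<close>

lemma double_sum_sums:
  assumes q: "norm q < 1"
    and pair: "bailey_pair q s \<alpha> (\<lambda>n. \<Sum>i\<le>n. q ^ (i ^ 2 + t * i) / (qpoch q q i * qpoch q q (n - i)))"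
    and A: "\<And>r. norm (\<alpha> r) \<le> A"
    and w: "\<And>n. bailey_weight q s x n = w n"
    and S: "(\<lambda>r. w r * qpoch_inf (x * q ^ r) q * \<alpha> r) sums S"
  shows "(\<lambda>n. w n / qpoch q q n * (\<Sum>i=0..n. q ^ (i ^ 2 + t * i) * qbinom q n i))
      sums (S / qpoch_inf q q)"
proof -
  obtain B where B: "\<And>n. norm (\<Sum>i\<le>n. q ^ (i ^ 2 + t * i) / (qpoch q q i * qpoch q q (n - i))) \<le> B"
    using iterated_beta_bounded[OF q] by blast
  show ?thesis
    using bailey_limit[OF q pair A B, of x S] S qpoch_qq_nonzero[OF q]
    unfolding w sum_qbinom_eq by simp
qed

section \<open>Exponent arithmetic, concrete Bailey pairs and weights\<close>

lemma square_eq_choose_two: "n ^ 2 = 2 * (n choose 2) + (n::nat)"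
  by (induction n) (simp_all add: numeral_2_eq_2 algebra_simps)

lemma triangle_eq_choose_two: "n * (n + 1) div 2 = (n choose 2) + (n::nat)"
proof -
  have "n * (n + 1) = 2 * ((n choose 2) + n)"
    using square_eq_choose_two[of n] by (simp add: power2_eq_square)
  then show ?thesis by simp
qed

lemma unit_seq_power: "unit_seq (q ^ k) r = (- 1) ^ r * q ^ (k * (r choose 2))"
  by (simp add: unit_seq_def power_mult)

lemma norm_unit_seq_le: "norm q < 1 \<Longrightarrow> norm (unit_seq q r) \<le> 1"
  by (simp add: unit_seq_def norm_mult norm_power power_le_one)

lemma bailey_pair_one:
  assumes q: "norm q < 1"
  shows "bailey_pair q 1 (\<lambda>r. (1 - q ^ (2 * r + 1)) * (q ^ (2 * (r ^ 2 + r)) * unit_seq q r))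
    (\<lambda>n. \<Sum>i\<le>n. q ^ (i ^ 2 + 1 * i) / (qpoch q q i * qpoch q q (n - i)))"
  using iterated_bailey_pair[OF q unit_bailey_pair[OF q]] by (simp add: mult_ac)

text \<open>The unit pair is first lowered to \<open>a = 1\<close> and then iterated. The factor
  \<open>1 + q ^ r\<close> arises because, for r = i + 1,
  \<open>q ^ (2 * i + 1) * unit_seq q i\<close> equals
  \<open>- (q ^ r) * unit_seq q r\<close>.\<close>

lemma bailey_pair_zero:
  assumes q: "norm q < 1"
  shows "bailey_pair q 0 (\<lambda>r. case r of 0 \<Rightarrow> 1 | Suc _ \<Rightarrow> q ^ (2 * r ^ 2) * unit_seq q r * (1 + q ^ r))
    (\<lambda>n. \<Sum>i\<le>n. q ^ (i ^ 2 + 0 * i) / (qpoch q q i * qpoch q q (n - i)))"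
proof -
  have "q ^ (2 * (r ^ 2 + 0 * r))
      * (case r of 0 \<Rightarrow> unit_seq q 0 | Suc i \<Rightarrow> unit_seq q r - q ^ (2 * i + 1) * unit_seq q i)
     = (case r of 0 \<Rightarrow> 1 | Suc _ \<Rightarrow> q ^ (2 * r ^ 2) * unit_seq q r * (1 + q ^ r))" for r
    by (cases r) (simp_all add: unit_seq_Suc power_double algebra_simps)
  with iterated_bailey_pair[OF q bailey_pair_lower[OF q unit_bailey_pair[OF q]]]
  show ?thesis by simp
qed

text \<open>Here the order is reversed: iteration relative to \<open>a = q\<close> comes first,
  lowering second. Beta thus keeps the exponents \<open>i ^ 2 + i\<close> although the pair is
  relative to \<open>a = 1\<close>.\<close>

lemma bailey_pair_mixed:
  assumes q: "norm q < 1"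
  shows "bailey_pair q 0 (\<lambda>r. case r of 0 \<Rightarrow> 1 | Suc _ \<Rightarrow> (- 1) ^ r * q ^ (5 * (r choose 2) + r)
      * (1 + q ^ (3 * r)))
    (\<lambda>n. \<Sum>i\<le>n. q ^ (i ^ 2 + 1 * i) / (qpoch q q i * qpoch q q (n - i)))"
proof -
  have "(case r of 0 \<Rightarrow> q ^ (2 * (0 ^ 2 + 0)) * unit_seq q 0
         | Suc i \<Rightarrow> q ^ (2 * (r ^ 2 + r)) * unit_seq q r - q ^ (2 * i + 1)
             * (q ^ (2 * (i ^ 2 + i)) * unit_seq q i))
     = (case r of 0 \<Rightarrow> 1 | Suc _ \<Rightarrow> (- 1) ^ r * q ^ (5 * (r choose 2) + r) * (1 + q ^ (3 * r)))" for r
  proof (cases r)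
    case (Suc i)
    have "Suc i choose 2 = (i choose 2) + i" by (simp add: numeral_2_eq_2)
    \<comment> \<open>The exponents of the two terms merged by lowering differ by
      \<open>3 * r\<close>, which yields the factor \<open>1 + q ^ (3 * r)\<close>.\<close>
    then have e: "2 * (r ^ 2 + r) + (r choose 2) = 5 * (r choose 2) + r + 3 * r"
      "2 * i + 1 + (2 * (i ^ 2 + i) + (i choose 2)) = 5 * (r choose 2) + r"
      unfolding square_eq_choose_two by (simp_all add: Suc)
    have "q ^ (2 * (r ^ 2 + r)) * unit_seq q r - q ^ (2 * i + 1) * (q ^ (2 * (i ^ 2 + i)) * unit_seq q i)
       = (- 1) ^ r * (q ^ (2 * (r ^ 2 + r) + (r choose 2))
           + q ^ (2 * i + 1 + (2 * (i ^ 2 + i) + (i choose 2))))"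
      unfolding unit_seq_def by (simp only: power_add) (simp add: Suc algebra_simps)
    also have "\<dots> = (- 1) ^ r * q ^ (5 * (r choose 2) + r) * (1 + q ^ (3 * r))"
      unfolding e power_add[of q "5 * (r choose 2) + r"] by
          (simp only: distrib_left mult.assoc mult_1_right add.commute)
    finally show ?thesis by (simp only: Suc nat.case)
  qed simp
  with bailey_pair_lower[OF q bailey_pair_one[OF q]] show ?thesis by simp
qed

text \<open>In terms of the free parameter rho, the first line is rho = -1 and the other three are
  rho = -q, the last two of them in base \<open>q ^ 2\<close>.\<close>

lemma bailey_weight_cases:
  "bailey_weight q 0 (- q) n = q ^ (n * (n + 1) div 2) * qpoch (- 1) q n"
  "bailey_weight q 1 (- q) n = q ^ (n * (n + 1) div 2) * qpoch (- q) q n"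
  "bailey_weight (q ^ 2) 0 (- q) n = q ^ (n ^ 2) * qpoch (- q) (q ^ 2) n"
  "bailey_weight (q ^ 2) 1 (- (q ^ 3)) n = q ^ (n ^ 2 + 2 * n) * qpoch (- q) (q ^ 2) n"
proof -
  have c: "Suc n choose 2 = (n choose 2) + n" "0 choose 2 = (0::nat)" for n by
      (simp_all add: numeral_2_eq_2)
  note s = bailey_weight_Suc qpoch_Suc power_add power_mult_distrib power2_eq_square power3_eq_cube algebra_simps
  show "bailey_weight q 0 (- q) n = q ^ (n * (n + 1) div 2) * qpoch (- 1) q n"
    unfolding triangle_eq_choose_two by (induction n) (simp_all add: c s)
  show "bailey_weight q 1 (- q) n = q ^ (n * (n + 1) div 2) * qpoch (- q) q n"
    unfolding triangle_eq_choose_two by (induction n) (simp_all add: c s)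
  show "bailey_weight (q ^ 2) 0 (- q) n = q ^ (n ^ 2) * qpoch (- q) (q ^ 2) n"
    by (induction n) (simp_all add: s)
  have "q ^ (n * 4) = q ^ n * q ^ n * q ^ n * q ^ n" for n
    using power_double(2)[of q "n * 2"] by (simp add: power_double mult.assoc)
  then show "bailey_weight (q ^ 2) 1 (- (q ^ 3)) n = q ^ (n ^ 2 + 2 * n) * qpoch (- q) (q ^ 2) n"
    by (induction n) (simp_all add: s power_double)
qed

text \<open>Reduces matching an alpha with a theta term to comparing exponents, which is linear once
  squares are expressed through \<open>r choose 2\<close> and \<open>r\<close>.\<close>

lemma unit_seq_monomial:
  assumes "m + j * (r choose 2) = k * (r choose 2) + l * r"
  shows "q ^ m * unit_seq (q ^ j) r = unit_seq (q ^ k) r * (q ^ l) ^ r"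
proof -
  have "q ^ m * q ^ (j * (r choose 2)) = q ^ (k * (r choose 2)) * q ^ (l * r)"
    by (simp only: power_add[symmetric] assms)
  then show ?thesis by (simp add: unit_seq_power power_mult[symmetric] mult_ac)
qed

lemma norm_one_pm_power_le:
  fixes q :: complex
  assumes "norm q < 1"
  shows "norm (1 + q ^ n) \<le> 2" "norm (1 - q ^ n) \<le> 2"
proof -
  have "norm (q ^ n) \<le> 1" using assms by (simp add: norm_power power_le_one)
  then show "norm (1 + q ^ n) \<le> 2" "norm (1 - q ^ n) \<le> 2"
    using norm_triangle_ineq[of 1 "q ^ n"] norm_triangle_ineq4[of 1 "q ^ n"] by simp_all
qed

lemma norm_alpha_le:
  assumes q: "norm q < 1"
  shows "norm ((1 - q ^ (2 * r + 1)) * (q ^ (2 * (r ^ 2 + r)) * unit_seq q r)) \<le> 2"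
    and "norm (case r of 0 \<Rightarrow> 1 | Suc _ \<Rightarrow> q ^ (2 * r ^ 2) * unit_seq q r * (1 + q ^ r)) \<le> 2"
    and "norm (case r of 0 \<Rightarrow> 1 | Suc _ \<Rightarrow> (- 1) ^ r * q ^ (5 * (r choose 2) + r) * (1 + q ^ (3 * r))) \<le> 2"
proof -
  have p: "norm (q ^ n) \<le> 1" for n using q by (simp add: norm_power power_le_one)
  have m: "norm (x * y) \<le> 2" if "norm x \<le> 1" "norm y \<le> 2" for x y :: complex
    using mult_mono[OF that] by (simp add: norm_mult)
  have u: "norm (q ^ n * unit_seq q r) \<le> 1" for n
    using mult_mono[OF p[of n] norm_unit_seq_le[OF q, of r]] by (simp add: norm_mult)
  show "norm ((1 - q ^ (2 * r + 1)) * (q ^ (2 * (r ^ 2 + r)) * unit_seq q r)) \<le> 2"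
    by (subst mult.commute) (intro m u norm_one_pm_power_le q)
  show "norm (case r of 0 \<Rightarrow> 1 | Suc _ \<Rightarrow> q ^ (2 * r ^ 2) * unit_seq q r * (1 + q ^ r)) \<le> 2"
  proof (cases r)
    case (Suc i)
    then show ?thesis using m[OF u norm_one_pm_power_le(1)[OF q]] by (simp only: nat.case)
  qed simp
  have "norm ((- 1) ^ r * q ^ n) \<le> 1" for n using p[of n] by (simp add: norm_mult norm_power)
  then show "norm (case r of 0 \<Rightarrow> 1 | Suc _ \<Rightarrow> (- 1) ^ r * q ^ (5 * (r choose 2) + r)
      * (1 + q ^ (3 * r))) \<le> 2"
  proof (cases r)
    case (Suc i)
    have "norm ((- 1) ^ Suc i * q ^ (5 * (Suc i choose 2) + Suc i) * (1 + q ^ (3 * Suc i))) \<le> 2"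
      using \<open>\<And>n. norm ((- 1) ^ r * q ^ n) \<le> 1\<close> unfolding Suc by (intro m norm_one_pm_power_le q)
    then show ?thesis unfolding Suc by (simp only: nat.case)
  qed simp
qed

section \<open>Evaluation of the five double sums by theta series\<close>

lemma triangle_sum_one:
  assumes q: "norm q < 1"
  shows "(\<lambda>n. q ^ (n * (n + 1) div 2) * qpoch (- 1) q n / qpoch q q n
      * (\<Sum>i=0..n. q ^ (i ^ 2 + 0 * i) * qbinom q n i))
    sums (qpoch_inf (- q) q * (qpoch_inf (q ^ 3) (q ^ 6) * qpoch_inf (q ^ 3) (q ^ 6)
        * qpoch_inf (q ^ 6) (q ^ 6)) / qpoch_inf q q)"
proof (rule double_sum_sums[OF q bailey_pair_zero[OF q] norm_alpha_le(2)[OF q] bailey_weight_cases(1)])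
  let ?\<alpha> = "\<lambda>r. case r of 0 \<Rightarrow> 1 | Suc _ \<Rightarrow> q ^ (2 * r ^ 2) * unit_seq q r * (1 + q ^ r)"
  let ?\<theta> = "\<lambda>r. case r of 0 \<Rightarrow> 1 | Suc _ \<Rightarrow> unit_seq (q ^ 6) r * ((q ^ 3) ^ r + (q ^ 3) ^ r)"
  have "norm (q ^ 6) < 1" using q by (simp add: norm_power power_less_one_iff)
  then have "?\<theta> sums (qpoch_inf (q ^ 3) (q ^ 6) * qpoch_inf (q ^ 3) (q ^ 6) * qpoch_inf (q ^ 6) (q ^ 6))"
    by (intro triple_product_sums(1)) (simp_all add: power_add[symmetric])
  moreover have "q ^ (r * (r + 1) div 2) * qpoch (- 1) q r * qpoch_inf (- q * q ^ r) q * ?\<alpha> r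
      = qpoch_inf (- q) q * ?\<theta> r" for r
  proof (cases r)
    case (Suc i)
    \<comment> \<open>Peels the last and the first factor off \<open>qpoch (- 1) q (Suc r)\<close>.
      The resulting 2 matches the two equal powers in the theta term, whose arguments are both
      \<open>q ^ 3\<close>.\<close>
    have "qpoch (- 1) q r * (1 + q ^ r) = 2 * qpoch (- q) q r"
      using qpoch_Suc[of "- 1" q r] qpoch_Suc_left[of "- 1" q r] by simp
    moreover have "q ^ (r * (r + 1) div 2 + 2 * r ^ 2) * unit_seq (q ^ 1) r = unit_seq (q ^ 6) r
        * (q ^ 3) ^ r"
      by (rule unit_seq_monomial) (unfold triangle_eq_choose_two square_eq_choose_two, simp)
    ultimately have "(q ^ (r * (r + 1) div 2 + 2 * r ^ 2) * unit_seq (q ^ 1) r)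
        * (qpoch (- 1) q r * (1 + q ^ r)) * qpoch_inf (- q * q ^ r) q
      = (unit_seq (q ^ 6) r * (q ^ 3) ^ r) * 2 * (qpoch (- q) q r * qpoch_inf (- q * q ^ r) q)"
      by (simp only: mult.assoc)
    then show ?thesis
      unfolding qpoch_inf_split[OF q, of "- q" r, symmetric] power_add
      unfolding Suc nat.case by (simp only: power_one_right mult_2_right[symmetric] mult_ac)
  qed simp
  ultimately show "(\<lambda>r. q ^ (r * (r + 1) div 2) * qpoch (- 1) q r * qpoch_inf (- q * q ^ r) q
      * ?\<alpha> r) sums
     (qpoch_inf (- q) q * (qpoch_inf (q ^ 3) (q ^ 6) * qpoch_inf (q ^ 3) (q ^ 6)
         * qpoch_inf (q ^ 6) (q ^ 6)))"
    by (simp only: sums_mult)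
qed

text \<open>The factor \<open>1 - q ^ (2 * r + 1)\<close> of alpha is what pairing index
  \<open>r\<close> with -(r+1) produces, so the second form of the triple product applies.\<close>

lemma triangle_sum_two:
  assumes q: "norm q < 1"
  shows "(\<lambda>n. q ^ (n * (n + 1) div 2) * qpoch (- q) q n / qpoch q q n
      * (\<Sum>i=0..n. q ^ (i ^ 2 + 1 * i) * qbinom q n i))
    sums (qpoch_inf (- q) q * (qpoch_inf (q ^ 5) (q ^ 6) * qpoch_inf q (q ^ 6)
        * qpoch_inf (q ^ 6) (q ^ 6)) / qpoch_inf q q)"
proof (rule double_sum_sums[OF q bailey_pair_one[OF q] norm_alpha_le(1)[OF q] bailey_weight_cases(2)])
  let ?\<alpha> = "\<lambda>r. (1 - q ^ (2 * r + 1)) * (q ^ (2 * (r ^ 2 + r)) * unit_seq q r)"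
  let ?\<theta> = "\<lambda>r. unit_seq (q ^ 6) r * ((q ^ 5) ^ r - (q ^ 6) ^ r * q ^ Suc r)"
  have "norm (q ^ 6) < 1" using q by (simp add: norm_power power_less_one_iff)
  then have "?\<theta> sums (qpoch_inf (q ^ 5) (q ^ 6) * qpoch_inf q (q ^ 6) * qpoch_inf (q ^ 6) (q ^ 6))"
    by (intro triple_product_sums(2)) (simp_all add: power_add[symmetric] power_Suc2[symmetric])
  moreover have "q ^ (r * (r + 1) div 2) * qpoch (- q) q r * qpoch_inf (- q * q ^ r) q * ?\<alpha> r
      = qpoch_inf (- q) q * ?\<theta> r" for r
  proof -
    have "q ^ (r * (r + 1) div 2 + 2 * (r ^ 2 + r)) * unit_seq (q ^ 1) r = unit_seq (q ^ 6) r
        * (q ^ 5) ^ r"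
      by (rule unit_seq_monomial) (unfold triangle_eq_choose_two square_eq_choose_two, simp)
    moreover have "(q ^ 5) ^ r - (q ^ 6) ^ r * q ^ Suc r = (q ^ 5) ^ r * (1 - q ^ (2 * r + 1))"
      by (simp add: right_diff_distrib power_mult[symmetric] power_add[symmetric] power_Suc[symmetric] del: power_Suc)
    ultimately have "qpoch_inf (- q) q * ?\<theta> r = qpoch_inf (- q) q
        * ((q ^ (r * (r + 1) div 2 + 2 * (r ^ 2 + r)) * unit_seq (q ^ 1) r) * (1 - q ^ (2 * r + 1)))"
      by (simp only: mult.assoc)
    then show ?thesis
      unfolding qpoch_inf_split[OF q, of "- q" r] power_add[of q "r * (r + 1) div 2"]
      by (simp only: power_one_right mult_ac)
  qed
  ultimately show "(\<lambda>r. q ^ (r * (r + 1) div 2) * qpoch (- q) q r * qpoch_inf (- q * q ^ r) q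
      * ?\<alpha> r) sums
     (qpoch_inf (- q) q * (qpoch_inf (q ^ 5) (q ^ 6) * qpoch_inf q (q ^ 6) * qpoch_inf (q ^ 6) (q ^ 6)))"
    by (simp only: sums_mult)
qed

lemma square_sum_three:
  assumes q: "norm q < 1"
  shows "(\<lambda>n. q ^ (n ^ 2) * qpoch (- q) (q ^ 2) n / qpoch (q ^ 2) (q ^ 2) n
      * (\<Sum>i=0..n. (q ^ 2) ^ (i ^ 2 + 0 * i) * qbinom (q ^ 2) n i))
    sums (qpoch_inf (- q) (q ^ 2) * (qpoch_inf (q ^ 5) (q ^ 12) * qpoch_inf (q ^ 7) (q ^ 12)
        * qpoch_inf (q ^ 12) (q ^ 12)) / qpoch_inf (q ^ 2) (q ^ 2))"
proof -
  have p: "norm (q ^ 2) < 1" "norm (q ^ 12) < 1" using q by (simp_all add: norm_power power_less_one_iff)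
  let ?\<alpha> = "\<lambda>r. case r of 0 \<Rightarrow> 1 | Suc _ \<Rightarrow> (q ^ 2) ^ (2 * r ^ 2) * unit_seq (q ^ 2) r * (1 + (q ^ 2) ^ r)"
  let ?\<theta> = "\<lambda>r. case r of 0 \<Rightarrow> 1 | Suc _ \<Rightarrow> unit_seq (q ^ 12) r * ((q ^ 5) ^ r + (q ^ 7) ^ r)"
  have "?\<theta> sums (qpoch_inf (q ^ 5) (q ^ 12) * qpoch_inf (q ^ 7) (q ^ 12) * qpoch_inf (q ^ 12) (q ^ 12))"
    by (intro triple_product_sums(1) p) (simp add: power_add[symmetric])
  moreover have "q ^ (r ^ 2) * qpoch (- q) (q ^ 2) r * qpoch_inf (- q * (q ^ 2) ^ r) (q ^ 2) * ?\<alpha> r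
      = qpoch_inf (- q) (q ^ 2) * ?\<theta> r" for r
  proof (cases r)
    case (Suc i)
    have "q ^ (r ^ 2 + 2 * (2 * r ^ 2)) * unit_seq (q ^ 2) r = unit_seq (q ^ 12) r * (q ^ 5) ^ r"
      by (rule unit_seq_monomial) (simp add: square_eq_choose_two)
    moreover have "(q ^ 5) ^ r + (q ^ 7) ^ r = (q ^ 5) ^ r * (1 + (q ^ 2) ^ r)"
      by (simp add: distrib_left power_mult[symmetric] power_add[symmetric])
    ultimately have "unit_seq (q ^ 12) r * ((q ^ 5) ^ r + (q ^ 7) ^ r)
        = q ^ (r ^ 2 + 2 * (2 * r ^ 2)) * unit_seq (q ^ 2) r * (1 + (q ^ 2) ^ r)"
      by (simp only: mult.assoc)
    then show ?thesis
      unfolding qpoch_inf_split[OF p(1), of "- q" r] power_add[of q "r ^ 2"] power_mult[of q 2 "2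
          * r ^ 2"]
      unfolding Suc nat.case by (simp only: mult_ac)
  qed simp
  ultimately have "(\<lambda>r. q ^ (r ^ 2) * qpoch (- q) (q ^ 2) r * qpoch_inf (- q * (q ^ 2) ^ r) (q ^ 2)
      * ?\<alpha> r) sums
     (qpoch_inf (- q) (q ^ 2) * (qpoch_inf (q ^ 5) (q ^ 12) * qpoch_inf (q ^ 7) (q ^ 12)
         * qpoch_inf (q ^ 12) (q ^ 12)))"
    by (simp only: sums_mult)
  then show ?thesis
    by (rule double_sum_sums[OF p(1) bailey_pair_zero[OF p(1)] norm_alpha_le(2)[OF p(1)] bailey_weight_cases(3)])
qed

lemma square_sum_four:
  assumes q: "norm q < 1"
  shows "(\<lambda>n. q ^ (n ^ 2) * qpoch (- q) (q ^ 2) n / qpoch (q ^ 2) (q ^ 2) n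
      * (\<Sum>i=0..n. (q ^ 2) ^ (i ^ 2 + 1 * i) * qbinom (q ^ 2) n i))
    sums (qpoch_inf (- q) (q ^ 2) * (qpoch_inf (q ^ 3) (q ^ 12) * qpoch_inf (q ^ 9) (q ^ 12)
        * qpoch_inf (q ^ 12) (q ^ 12)) / qpoch_inf (q ^ 2) (q ^ 2))"
proof -
  have p: "norm (q ^ 2) < 1" "norm (q ^ 12) < 1" using q by (simp_all add: norm_power power_less_one_iff)
  let ?\<alpha> = "\<lambda>r. case r of 0 \<Rightarrow> 1 | Suc _ \<Rightarrow> (- 1) ^ r * (q ^ 2) ^ (5 * (r choose 2) + r)
      * (1 + (q ^ 2) ^ (3 * r))"
  let ?\<theta> = "\<lambda>r. case r of 0 \<Rightarrow> 1 | Suc _ \<Rightarrow> unit_seq (q ^ 12) r * ((q ^ 3) ^ r + (q ^ 9) ^ r)"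
  have "?\<theta> sums (qpoch_inf (q ^ 3) (q ^ 12) * qpoch_inf (q ^ 9) (q ^ 12) * qpoch_inf (q ^ 12) (q ^ 12))"
    by (intro triple_product_sums(1) p) (simp add: power_add[symmetric])
  moreover have "q ^ (r ^ 2) * qpoch (- q) (q ^ 2) r * qpoch_inf (- q * (q ^ 2) ^ r) (q ^ 2) * ?\<alpha> r
      = qpoch_inf (- q) (q ^ 2) * ?\<theta> r" for r
  proof (cases r)
    case (Suc i)
    \<comment> \<open>Base \<open>q ^ 0\<close> reduces \<open>unit_seq\<close> to the bare sign, so
      that \<open>unit_seq_monomial\<close> fits an alpha whose power of \<open>q\<close> is already
      written out.\<close>
    have "q ^ (r ^ 2 + 2 * (5 * (r choose 2) + r)) * unit_seq (q ^ 0) r = unit_seq (q ^ 12) r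
        * (q ^ 3) ^ r"
      by (rule unit_seq_monomial) (simp add: square_eq_choose_two)
    moreover have "(q ^ 3) ^ r + (q ^ 9) ^ r = (q ^ 3) ^ r * (1 + (q ^ 2) ^ (3 * r))"
      by (simp add: distrib_left power_mult[symmetric] power_add[symmetric])
    ultimately have "unit_seq (q ^ 12) r * ((q ^ 3) ^ r + (q ^ 9) ^ r)
        = q ^ (r ^ 2 + 2 * (5 * (r choose 2) + r)) * unit_seq (q ^ 0) r * (1 + (q ^ 2) ^ (3 * r))"
      by (simp only: mult.assoc)
    moreover have "unit_seq (q ^ 0) r = (- 1) ^ r" by (simp add: unit_seq_def)
    ultimately show ?thesis
      unfolding qpoch_inf_split[OF p(1), of "- q" r] power_add[of q "r ^ 2"] power_mult[of q 2 "5
          * (r choose 2) + r"]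
      unfolding Suc nat.case by (simp only: mult_ac)
  qed simp
  ultimately have "(\<lambda>r. q ^ (r ^ 2) * qpoch (- q) (q ^ 2) r * qpoch_inf (- q * (q ^ 2) ^ r) (q ^ 2)
      * ?\<alpha> r) sums
     (qpoch_inf (- q) (q ^ 2) * (qpoch_inf (q ^ 3) (q ^ 12) * qpoch_inf (q ^ 9) (q ^ 12)
         * qpoch_inf (q ^ 12) (q ^ 12)))"
    by (simp only: sums_mult)
  then show ?thesis
    by (rule double_sum_sums[OF p(1) bailey_pair_mixed[OF p(1)] norm_alpha_le(3)[OF p(1)] bailey_weight_cases(3)])
qed

lemma square_sum_five:
  assumes q: "norm q < 1"
  shows "(\<lambda>n. q ^ (n ^ 2 + 2 * n) * qpoch (- q) (q ^ 2) n / qpoch (q ^ 2) (q ^ 2) n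
      * (\<Sum>i=0..n. (q ^ 2) ^ (i ^ 2 + 1 * i) * qbinom (q ^ 2) n i))
    sums (qpoch_inf (- q) (q ^ 2) * (qpoch_inf q (q ^ 12) * qpoch_inf (q ^ 11) (q ^ 12)
        * qpoch_inf (q ^ 12) (q ^ 12)) / qpoch_inf (q ^ 2) (q ^ 2))"
proof -
  have p: "norm (q ^ 2) < 1" "norm (q ^ 12) < 1" using q by (simp_all add: norm_power power_less_one_iff)
  let ?\<alpha> = "\<lambda>r. (1 - (q ^ 2) ^ (2 * r + 1)) * ((q ^ 2) ^ (2 * (r ^ 2 + r)) * unit_seq (q ^ 2) r)"
  let ?\<theta> = "\<lambda>r. unit_seq (q ^ 12) r * ((q ^ 11) ^ r - (q ^ 12) ^ r * q ^ Suc r)"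
  have "?\<theta> sums (qpoch_inf q (q ^ 12) * qpoch_inf (q ^ 11) (q ^ 12) * qpoch_inf (q ^ 12) (q ^ 12))"
    by (subst mult.commute[of "qpoch_inf q (q ^ 12)"], intro triple_product_sums(2) p)
       (simp add: power_Suc2[symmetric])
  moreover have "q ^ (r ^ 2 + 2 * r) * qpoch (- q) (q ^ 2) r
      * qpoch_inf (- (q ^ 3) * (q ^ 2) ^ r) (q ^ 2) * ?\<alpha> r = qpoch_inf (- q) (q ^ 2) * ?\<theta> r" for r
  proof -
    have "q ^ (r ^ 2 + 2 * r + 2 * (2 * (r ^ 2 + r))) * unit_seq (q ^ 2) r = unit_seq (q ^ 12) r
        * (q ^ 11) ^ r"
      by (rule unit_seq_monomial) (simp add: square_eq_choose_two)
    moreover have "(q ^ 11) ^ r - (q ^ 12) ^ r * q ^ Suc r = (q ^ 11) ^ r * (1 - q ^ (2 * r + 1))"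
      by (simp add: right_diff_distrib power_mult[symmetric] power_add[symmetric] power_Suc[symmetric] del: power_Suc)
    ultimately have "?\<theta> r = q ^ (r ^ 2 + 2 * r) * ((q ^ 2) ^ (2 * (r ^ 2 + r)) * unit_seq (q ^ 2) r)
        * (1 - q ^ (2 * r + 1))"
      by (simp only: mult.assoc power_add[of q "r ^ 2 + 2 * r"] power_mult[of q 2 "2 * (r ^ 2 + r)"])
    \<comment> \<open>With x = -q^3 the infinite product starts one factor later than in the
      previous two sums. The missing \<open>1 + q ^ (2 * r + 1)\<close> is split off from
      \<open>1 - (q ^ 2) ^ (2 * r + 1)\<close>, which leaves the factor of the theta term.\<close>
    moreover have "qpoch_inf (- q) (q ^ 2) = qpoch (- q) (q ^ 2) r * (1 + q ^ (2 * r + 1))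
        * qpoch_inf (- (q ^ 3) * (q ^ 2) ^ r) (q ^ 2)"
      using qpoch_inf_split[OF p(1), of "- q" "Suc r"]
      by (simp add: qpoch_Suc power_double power_mult_distrib power3_eq_cube power2_eq_square mult_ac)
    moreover have "1 - (q ^ 2) ^ (2 * r + 1) = (1 - q ^ (2 * r + 1)) * (1 + q ^ (2 * r + 1))"
      by (simp add: power_mult[symmetric] power_double power2_eq_square algebra_simps)
    ultimately show ?thesis by (simp only: mult_ac)
  qed
  ultimately have "(\<lambda>r. q ^ (r ^ 2 + 2 * r) * qpoch (- q) (q ^ 2) r
      * qpoch_inf (- (q ^ 3) * (q ^ 2) ^ r) (q ^ 2) * ?\<alpha> r) sums
     (qpoch_inf (- q) (q ^ 2) * (qpoch_inf q (q ^ 12) * qpoch_inf (q ^ 11) (q ^ 12)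
         * qpoch_inf (q ^ 12) (q ^ 12)))"
    by (simp only: sums_mult)
  then show ?thesis
    by (rule double_sum_sums[OF p(1) bailey_pair_one[OF p(1)] norm_alpha_le(1)[OF p(1)] bailey_weight_cases(4)])
qed

section \<open>Product forms of the first two identities\<close>

lemma triangle_product_one:
  assumes q: "norm q < 1"
  shows "qpoch_inf (- q) q * (qpoch_inf (q ^ 3) (q ^ 6) * qpoch_inf (q ^ 3) (q ^ 6)
      * qpoch_inf (q ^ 6) (q ^ 6)) / qpoch_inf q q
    = qpoch_inf (q ^ 2) (q ^ 2) * (qpoch_inf (q ^ 3) (q ^ 3)) ^ 2
        / ((qpoch_inf q q) ^ 2 * qpoch_inf (q ^ 6) (q ^ 6))"
proof -
  have p: "norm (q ^ 3) < 1" "norm (q ^ 6) < 1" using q by (simp_all add: norm_power power_less_one_iff)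
  have "qpoch_inf (q ^ 3) (q ^ 3) = qpoch_inf (q ^ 3) (q ^ 6) * qpoch_inf (q ^ 6) (q ^ 6)"
    using qpoch_inf_multisection[OF p(1), of 2 "q ^ 3"]
    by (simp add: numeral_2_eq_2 power_mult[symmetric] power_add[symmetric] flip: power_Suc)
  moreover have "qpoch_inf (q ^ 2) (q ^ 2) = qpoch_inf q q * qpoch_inf (- q) q"
    by (simp add: qpoch_inf_mult_minus[OF q])
  ultimately show ?thesis
    using qpoch_inf_qq_nonzero[OF q] qpoch_inf_qq_nonzero[OF p(2)]
    by (simp add: field_simps power2_eq_square)
qed

text \<open>Rests on Euler's identity (q;q^2)_inf (-q;q)_inf = 1, with the odd exponents sorted into
  the classes 1, 3 and 5 modulo 6.\<close>

lemma triangle_product_two: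
  assumes q: "norm q < 1"
  shows "qpoch_inf (- q) q * (qpoch_inf (q ^ 5) (q ^ 6) * qpoch_inf q (q ^ 6)
      * qpoch_inf (q ^ 6) (q ^ 6)) / qpoch_inf q q
    = (qpoch_inf (q ^ 6) (q ^ 6)) ^ 2 / (qpoch_inf q q * qpoch_inf (q ^ 3) (q ^ 3))"
proof -
  have p: "norm (q ^ 2) < 1" "norm (q ^ 3) < 1" "norm (q ^ 6) < 1" using q by
      (simp_all add: norm_power power_less_one_iff)
  note nz = qpoch_inf_qq_nonzero[OF q] qpoch_inf_qq_nonzero[OF p(1)] qpoch_inf_qq_nonzero[OF p(2)] qpoch_inf_qq_nonzero[OF p(3)]
  have h: "qpoch_inf (q ^ 3) (q ^ 3) = qpoch_inf (q ^ 3) (q ^ 6) * qpoch_inf (q ^ 6) (q ^ 6)"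
    using qpoch_inf_multisection[OF p(2), of 2 "q ^ 3"]
    by (simp add: numeral_2_eq_2 power_mult[symmetric] power_add[symmetric] flip: power_Suc)
  have "qpoch_inf q q = qpoch_inf q (q ^ 2) * qpoch_inf (q ^ 2) (q ^ 2)"
    using qpoch_inf_multisection[OF q, of 2 q] by (simp add: numeral_2_eq_2)
  also have "qpoch_inf (q ^ 2) (q ^ 2) = qpoch_inf q q * qpoch_inf (- q) q"
    by (simp add: qpoch_inf_mult_minus[OF q])
  also have "qpoch_inf q (q ^ 2) = qpoch_inf q (q ^ 6) * qpoch_inf (q ^ 3) (q ^ 6)
      * qpoch_inf (q ^ 5) (q ^ 6)"
  proof -
    have "{..<3} = {0, 1, 2::nat}" by auto
    then show ?thesis using qpoch_inf_multisection[OF p(1), of 3 q]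
      by (simp add: power_mult[symmetric] mult_ac flip: power_Suc)
  qed
  finally have "qpoch_inf q (q ^ 6) * qpoch_inf (q ^ 3) (q ^ 6) * qpoch_inf (q ^ 5) (q ^ 6)
      * qpoch_inf (- q) q = 1"
    using nz(1) by (simp add: mult.assoc)
  then show ?thesis
    using nz unfolding h by (simp add: field_simps power2_eq_square)
qed

theorem theorem3p3:
  fixes q :: complex
  assumes "norm q < 1"
  shows
   "((\<lambda>n. q ^ (n * (n + 1) div 2) * qpoch (-1) q n / qpoch q q n
        * (\<Sum>i=0..n. q ^ (i^2) * qbinom q n i))
      sums (qpoch_inf (q^2) (q^2) * (qpoch_inf (q^3) (q^3))^2
            / ((qpoch_inf q q)^2 * qpoch_inf (q^6) (q^6))))
    \<and>
    ((\<lambda>n. q ^ (n * (n + 1) div 2) * qpoch (-q) q n / qpoch q q n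
        * (\<Sum>i=0..n. q ^ (i^2 + i) * qbinom q n i))
      sums ((qpoch_inf (q^6) (q^6))^2 / (qpoch_inf q q * qpoch_inf (q^3) (q^3))))
    \<and>
    ((\<lambda>n. q ^ (n^2) * qpoch (-q) (q^2) n / qpoch (q^2) (q^2) n
        * (\<Sum>i=0..n. q ^ (2 * i^2) * qbinom (q^2) n i))
      sums (qpoch_inf (-q) (q^2) * qpoch_inf (q^5) (q^12) * qpoch_inf (q^7) (q^12)
              * qpoch_inf (q^12) (q^12) / qpoch_inf (q^2) (q^2)))
    \<and>
    ((\<lambda>n. q ^ (n^2) * qpoch (-q) (q^2) n / qpoch (q^2) (q^2) n
        * (\<Sum>i=0..n. q ^ (2 * i^2 + 2 * i) * qbinom (q^2) n i))
      sums (qpoch_inf (-q) (q^2) * qpoch_inf (q^3) (q^12) * qpoch_inf (q^9) (q^12)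
              * qpoch_inf (q^12) (q^12) / qpoch_inf (q^2) (q^2)))
    \<and>
    ((\<lambda>n. q ^ (n^2 + 2 * n) * qpoch (-q) (q^2) n / qpoch (q^2) (q^2) n
        * (\<Sum>i=0..n. q ^ (2 * i^2 + 2 * i) * qbinom (q^2) n i))
      sums (qpoch_inf (-q) (q^2) * qpoch_inf q (q^12) * qpoch_inf (q^11) (q^12)
              * qpoch_inf (q^12) (q^12) / qpoch_inf (q^2) (q^2)))"
  using triangle_sum_one[OF assms] triangle_sum_two[OF assms] square_sum_three[OF assms]
    square_sum_four[OF assms] square_sum_five[OF assms]
  unfolding triangle_product_one[OF assms] triangle_product_two[OF assms]
  unfolding power_mult[symmetric] distrib_left[of 2] mult_1_left mult_zero_left add_0_right mult.assoc
  by blast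

end
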